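(* Let $G$ be a minimal matching covered bipartite graph of order $n$. If $n\leq 4$, then $\rho(G)\leq 2$, with equality if and only if $G\cong C_4$. If $n\geq 6$, then $\rho(G)\leq \frac{1+\sqrt{2n-3}}{2}$, with equality if and only if $G\cong P^{*}_{3}$, where $P^{*}_{3}$ is the graph formed by the union of $\frac{n-2}{2}$ paths of length $3$ which all have the same two end vertices and whose internal vertices are pairwise distinct.
   Context: All graphs are finite, simple and connected. $\rho(G)$ denotes the spectral radius (largest eigenvalue) of the adjacency matrix of $G$. A connected nontrivial graph $G$ is matching covered if every edge of $G$ lies in some perfect matching of $G$. A matching covered graph $G$ is minimal if $G-e$ is not matching covered for every edge $e$ of $G$. $C_4$ is the cycle on $4$ vertices. *)

theory Defs
  imports
    "Graph_Theory.Graph_Theory"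
    "Jordan_Normal_Form.Spectral_Radius"
begin

text \<open>
  A finite simple graph is a \<^locale>\<open>pair_graph\<close>: a finite, symmetric, loop-free digraph without
  parallel arcs. An undirected edge \<open>uv\<close> is the pair of opposite arcs \<open>(u, v)\<close>, \<open>(v, u)\<close>; it is
  written as the two-element set \<open>{u, v}\<close> below.
\<close>

definition edges :: "'a pair_pre_digraph \<Rightarrow> 'a set set" where
  "edges G = (\<lambda>(u, v). {u, v}) ` parcs G"

definition delete_edge :: "'a pair_pre_digraph \<Rightarrow> 'a set \<Rightarrow> 'a pair_pre_digraph" where
  "delete_edge G e = G\<lparr>parcs := {(u, v) \<in> parcs G. {u, v} \<noteq> e}\<rparr>"

definition bipartite :: "'a pair_pre_digraph \<Rightarrow> bool" where
  "bipartite G \<longleftrightarrow> (\<exists>X Y. X \<union> Y = pverts G \<and> X \<inter> Y = {} \<and> parcs G \<subseteq> X \<times> Y \<union> Y \<times> X)"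

definition matching :: "'a pair_pre_digraph \<Rightarrow> 'a set set \<Rightarrow> bool" where
  "matching G M \<longleftrightarrow> M \<subseteq> edges G \<and> pairwise disjnt M"

definition perfect_matching :: "'a pair_pre_digraph \<Rightarrow> 'a set set \<Rightarrow> bool" where
  "perfect_matching G M \<longleftrightarrow> matching G M \<and> \<Union> M = pverts G"

definition matching_covered :: "'a pair_pre_digraph \<Rightarrow> bool" where
  "matching_covered G \<longleftrightarrow>
     Digraph_Component.connected (with_proj G) \<and> card (pverts G) \<ge> 2 \<and>
     (\<forall>e\<in>edges G. \<exists>M. perfect_matching G M \<and> e \<in> M)"

definition minimal_matching_covered :: "'a pair_pre_digraph \<Rightarrow> bool" where
  "minimal_matching_covered G \<longleftrightarrow>
     matching_covered G \<and> (\<forall>e\<in>edges G. \<not> matching_covered (delete_edge G e))"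

abbreviation graph_isomorphic ::
    "'a pair_pre_digraph \<Rightarrow> 'b pair_pre_digraph \<Rightarrow> bool" (infix \<open>\<cong>\<^sub>G\<close> 50) where
  "G \<cong>\<^sub>G H \<equiv> digraph_iso (with_proj G) (with_proj H)"

text \<open>The cycle on \<open>k\<close> vertices, for \<open>k \<ge> 3\<close>.\<close>

definition cycle_graph :: "nat \<Rightarrow> nat pair_pre_digraph" where
  "cycle_graph k = \<lparr>pverts = {..<k},
     parcs = (\<Union>i<k. {(i, Suc i mod k), (Suc i mod k, i)})\<rparr>"

text \<open>
  The union of \<open>k\<close> paths \<open>Left_End \<midarrow> Inner_Left i \<midarrow> Inner_Right i \<midarrow> Right_End\<close> of
  length 3, \<open>i < k\<close>. Its order is \<open>2 * k + 2\<close>.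
\<close>

datatype p3_vertex = Left_End | Right_End | Inner_Left nat | Inner_Right nat

definition P3_star :: "nat \<Rightarrow> p3_vertex pair_pre_digraph" where
  "P3_star k =
     (let R = (\<Union>i<k. {(Left_End, Inner_Left i), (Inner_Left i, Inner_Right i),
                       (Inner_Right i, Right_End)})
      in \<lparr>pverts = {Left_End, Right_End} \<union> Inner_Left ` {..<k} \<union> Inner_Right ` {..<k},
          parcs = R \<union> R\<inverse>\<rparr>)"

text \<open>
  The rows and columns of the adjacency matrix are indexed along an enumeration \<open>vs\<close> of the
  vertices. The spectral radius does not depend on it, as shown in
  \<open>graph_spectral_radius_eq\<close>.
\<close>

definition adjacency_matrix :: "'a pair_pre_digraph \<Rightarrow> 'a list \<Rightarrow> complex mat" where
  "adjacency_matrix G vs =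
     mat (length vs) (length vs) (\<lambda>(i, j). if (vs ! i, vs ! j) \<in> parcs G then 1 else 0)"

definition graph_spectral_radius :: "'a pair_pre_digraph \<Rightarrow> real" (\<open>\<rho>\<close>) where
  "\<rho> G = spectral_radius (adjacency_matrix G (SOME vs. distinct vs \<and> set vs = pverts G))"

lemma adjacency_matrix_mult_index:
  assumes vs: "distinct vs" "set vs = pverts G" and i: "i < length vs"
    and x: "\<And>j. j < length vs \<Longrightarrow> x $ j = f (vs ! j)" "x \<in> carrier_vec (length vs)"
  shows "(adjacency_matrix G vs *\<^sub>v x) $ i =
    (\<Sum>u\<in>pverts G. if (vs ! i, u) \<in> parcs G then f u else 0)"
proof -
  have "(adjacency_matrix G vs *\<^sub>v x) $ i =
      (\<Sum>j = 0..<length vs. if (vs ! i, vs ! j) \<in> parcs G then f (vs ! j) else 0)"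
    using i x by (auto simp: adjacency_matrix_def scalar_prod_def intro!: sum.cong)
  also have "\<dots> = (\<Sum>u\<in>set vs. if (vs ! i, u) \<in> parcs G then f u else 0)"
    by (rule sum.reindex_bij_betw)
      (use bij_betw_nth[OF vs(1), of "{0..<length vs}" "set vs"] in \<open>auto simp: lessThan_atLeast0\<close>)
  finally show ?thesis using vs by simp
qed

lemma eigenvalue_adjacency_matrix_iff:
  assumes vs: "distinct vs" "set vs = pverts G"
  shows "eigenvalue (adjacency_matrix G vs) k \<longleftrightarrow>
    (\<exists>f. (\<exists>v\<in>pverts G. f v \<noteq> 0) \<and>
         (\<forall>v\<in>pverts G. (\<Sum>u\<in>pverts G. if (v, u) \<in> parcs G then f u else 0) = k * f v))"
    (is "?L \<longleftrightarrow> ?R")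
proof
  let ?n = "length vs" and ?A = "adjacency_matrix G vs"
  have dim: "dim_row ?A = ?n" "dim_col ?A = ?n" by (simp_all add: adjacency_matrix_def)
  {
    assume ?L
    then obtain x where x: "x \<in> carrier_vec ?n" "x \<noteq> 0\<^sub>v ?n" "?A *\<^sub>v x = k \<cdot>\<^sub>v x"
      unfolding eigenvalue_def eigenvector_def dim by auto
    define f where "f v = x $ (THE j. j < ?n \<and> vs ! j = v)" for v
    have f: "x $ j = f (vs ! j)" if "j < ?n" for j
    proof -
      have "(THE l. l < ?n \<and> vs ! l = vs ! j) = j"
        using that vs(1) by (intro the_equality) (auto simp: nth_eq_iff_index_eq)
      then show ?thesis by (simp add: f_def)
    qed
    obtain j where "j < ?n" "x $ j \<noteq> 0" using x(1,2) by (metis carrier_vecD eq_vecI index_zero_vec)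
    then have nz: "\<exists>v\<in>pverts G. f v \<noteq> 0" using f vs(2) nth_mem by metis
    have "(\<Sum>u\<in>pverts G. if (v, u) \<in> parcs G then f u else 0) = k * f v"
      if v: "v \<in> pverts G" for v
    proof -
      obtain i where i: "i < ?n" "v = vs ! i" using v vs(2) by (metis in_set_conv_nth)
      show ?thesis
        using adjacency_matrix_mult_index[OF vs i(1) f x(1)] x i f by simp
    qed
    with nz show ?R by blast
  next
    assume ?R
    then obtain f where f: "\<exists>v\<in>pverts G. f v \<noteq> 0"
      "\<And>v. v \<in> pverts G \<Longrightarrow> (\<Sum>u\<in>pverts G. if (v, u) \<in> parcs G then f u else 0) = k * f v"
      by blast
    define x where "x = vec ?n (\<lambda>j. f (vs ! j))"
    have x: "x \<in> carrier_vec ?n" "\<And>j. j < ?n \<Longrightarrow> x $ j = f (vs ! j)" by (auto simp: x_def)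
    obtain j where "j < ?n" "f (vs ! j) \<noteq> 0" using f(1) vs(2) by (metis in_set_conv_nth)
    then have "x \<noteq> 0\<^sub>v ?n" using x by auto
    moreover have "?A *\<^sub>v x = k \<cdot>\<^sub>v x"
    proof (rule eq_vecI)
      fix i assume "i < dim_vec (k \<cdot>\<^sub>v x)"
      then have i: "i < ?n" using x by simp
      then have "vs ! i \<in> pverts G" using vs(2) nth_mem by blast
      then show "(?A *\<^sub>v x) $ i = (k \<cdot>\<^sub>v x) $ i"
        using adjacency_matrix_mult_index[where f = f, OF vs i x(2) x(1)] x i f(2) by simp
    qed (use x dim in simp)
    ultimately show ?L unfolding eigenvalue_def eigenvector_def dim using x by blast
  }
qed

lemma graph_spectral_radius_eq:
  assumes "distinct vs" "set vs = pverts G"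
  shows "\<rho> G = spectral_radius (adjacency_matrix G vs)"
proof -
  let ?ws = "SOME vs. distinct vs \<and> set vs = pverts G"
  have "distinct ?ws \<and> set ?ws = pverts G" by (rule someI) (use assms in blast)
  then have "spectrum (adjacency_matrix G ?ws) = spectrum (adjacency_matrix G vs)"
    unfolding spectrum_def using assms
    by (intro Collect_cong) (simp add: eigenvalue_adjacency_matrix_iff[of _ G])
  then show ?thesis by (simp add: graph_spectral_radius_def spectral_radius_def)
qed

end

theory Submission
  imports Defs "HOL-Combinatorics.Permutations" "HOL-Library.Transitive_Closure_Table"
begin

text \<open>
  Orienting the edges of a bipartite graph from \<open>X\<close> to \<open>Y\<close> and contracting a perfect matching
  yields a digraph on \<open>X\<close> that is strongly connected iff the graph is matching covered. For a
  minimal graph no arc of this digraph can be bypassed, which for \<open>n \<ge> 6\<close> excludes squares.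
  Hence a vertex reaches each of the \<open>k = n / 2 - 1\<close> other vertices on its side by at most one
  path of length two, that is, the row sums of \<open>A\<^sup>2 - A\<close> are at most \<open>k\<close>, and this gives
  \<open>\<rho>\<^sup>2 - \<rho> \<le> k\<close>. In case of equality the two sides are the points and lines of a possibly
  degenerate projective plane. A minimal strongly connected digraph has a vertex of out-degree one,
  so some point lies on only two lines; the plane is then a near-pencil, and its incidence graph
  is \<open>P\<^sup>*\<^sub>3\<close>.
\<close>

section \<open>Minimal strongly connected digraphs\<close>

text \<open>The spectral inequality alone does not single out \<open>P3_star\<close>: the incidence
  graph of a projective plane of order \<open>q\<close> has spectral radius \<open>q + 1\<close> and
  \<open>k = q * q + q\<close>, so it also attains \<open>\<rho> * \<rho> = \<rho> + k\<close>.
  Minimality is therefore used twice, once to exclude squares and once more, through the vertex of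
  out-degree one, to exclude such planes. The bound is the larger root of
  \<open>t * t = t + k\<close>, whose discriminant is \<open>4 * k + 1 = 2 * n - 3\<close>.
  Minimality passes to the digraph because the matching edges become loops: deleting any other edge
  keeps the matching and removes exactly one proper arc. The matching can be chosen freely, and
  squares are excluded by comparing two matchings. No Perron eigenvector is presupposed: the moduli
  of a complex eigenvector satisfy an inequality, and only the equality case, by making all summed
  estimates tight, turns them into a positive eigenvector.\<close>

text \<open>Strong connectivity, stated through the vertex sets closed under out-neighbours.\<close>

definition strong :: "'a set \<Rightarrow> 'a rel \<Rightarrow> bool" where
  "strong X D \<longleftrightarrow> (\<forall>S\<subseteq>X. S \<noteq> {} \<longrightarrow> D `` S \<subseteq> S \<longrightarrow> S = X)"

lemma strongD: "strong X D \<Longrightarrow> S \<subseteq> X \<Longrightarrow> S \<noteq> {} \<Longrightarrow> D `` S \<subseteq> S \<Longrightarrow> S = X"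
  unfolding strong_def by blast

lemma strong_reachable:
  assumes "strong X D" "D \<subseteq> X \<times> X" "x \<in> X" "y \<in> X"
  shows "(x, y) \<in> D\<^sup>*"
proof -
  let ?S = "D\<^sup>* `` {x}"
  have "?S \<subseteq> X"
  proof
    fix z assume "z \<in> ?S"
    then have "(x, z) \<in> D\<^sup>*" by simp
    then show "z \<in> X" using assms(2,3) by induction auto
  qed
  moreover have "D `` ?S \<subseteq> ?S" by (auto intro: rtrancl_into_rtrancl)
  ultimately have "?S = X" using assms(1) by (intro strongD[of X D]) auto
  then show ?thesis using assms(4) by auto
qed

text \<open>A set closed under the remaining arcs is also closed along the bypass, hence under the
  deleted arc.\<close>

lemma strong_delete_arc:
  assumes "strong X D" "D \<subseteq> X \<times> X" "(x, y) \<in> (D - {(x, y)})\<^sup>*"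
  shows "strong X (D - {(x, y)})"
  unfolding strong_def
proof (intro allI impI)
  fix S assume S: "S \<subseteq> X" "S \<noteq> {}" "(D - {(x, y)}) `` S \<subseteq> S"
  have "z \<in> S" if "(x, z) \<in> (D - {(x, y)})\<^sup>*" "x \<in> S" for z
    using that S(3) by (induction) auto
  then have "x \<in> S \<Longrightarrow> y \<in> S" using assms(3) by blast
  then have "D `` S \<subseteq> S" using S(3) by auto
  then show "S = X" using S assms(1) strongD by blast
qed

text \<open>\<open>\<sigma>\<close> is the cycle along the path that jumps back from
  \<open>y\<close> to \<open>x\<close>. Composed with a matching it switches the matching along an
  alternating cycle; the jump is left unconstrained because it stands for the edge to be brought
  in.\<close>

lemma path_closing_permutation:
  assumes "rtrancl_path (\<lambda>u v. (u, v) \<in> D) x xs y" "distinct (x # xs)"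
  shows "\<exists>\<sigma>. \<sigma> permutes set (x # xs) \<and> \<sigma> y = x \<and> (\<forall>u. u \<noteq> y \<longrightarrow> \<sigma> u = u \<or> (u, \<sigma> u) \<in> D)"
  using assms
proof (induction rule: rtrancl_path.induct)
  case (base x)
  then show ?case by (intro exI[of _ id]) (auto simp: permutes_id)
next
  case (step x y ys z)
  then obtain \<sigma> where \<sigma>: "\<sigma> permutes set (y # ys)" "\<sigma> z = y"
    "\<And>u. u \<noteq> z \<Longrightarrow> \<sigma> u = u \<or> (u, \<sigma> u) \<in> D" by auto
  have zin: "z \<in> set (y # ys)"
    using step.hyps(2) by (induction rule: rtrancl_path.induct) auto
  have "x \<notin> set (y # ys)" using step.prems by simp
  then have x: "\<sigma> x = x" "x \<noteq> z" using \<sigma>(1) zin by (meson permutes_not_in, blast)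
  \<comment> \<open>\<open>x\<close> goes to \<open>\<sigma> z = y\<close>, along the first arc, and
    \<open>z\<close> goes to \<open>\<sigma> x = x\<close>, the new closing jump.\<close>
  let ?\<tau> = "\<sigma> \<circ> transpose x z"
  have "?\<tau> permutes set (x # y # ys)"
    by (rule permutes_compose[OF permutes_swap_id permutes_subset[OF \<sigma>(1)]]) (use zin in auto)
  moreover have "?\<tau> z = x" using x by simp
  moreover have "?\<tau> u = u \<or> (u, ?\<tau> u) \<in> D" if "u \<noteq> z" for u
    using that \<sigma>(2,3) x step.hyps(1) by (cases "u = x") (auto simp: transpose_apply_other)
  ultimately show ?case by blast
qed

lemma reachable_closing_permutation:
  assumes "(x, y) \<in> D\<^sup>*" "D \<subseteq> X \<times> X" "x \<in> X"
  shows "\<exists>\<sigma>. \<sigma> permutes X \<and> \<sigma> y = x \<and> (\<forall>u. u \<noteq> y \<longrightarrow> \<sigma> u = u \<or> (u, \<sigma> u) \<in> D)"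
proof -
  have "(\<lambda>u v. (u, v) \<in> D)\<^sup>*\<^sup>* x y" using assms(1) by (simp add: rtranclp_rtrancl_eq)
  then obtain xs where xs: "rtrancl_path (\<lambda>u v. (u, v) \<in> D) x xs y"
    by (auto simp: rtranclp_eq_rtrancl_path)
  obtain ys where ys: "rtrancl_path (\<lambda>u v. (u, v) \<in> D) x ys y" "distinct (x # ys)"
    using rtrancl_path_distinct[OF xs] by blast
  have "set ys \<subseteq> X" using ys(1) assms(2) by (induction rule: rtrancl_path.induct) auto
  then show ?thesis
    using path_closing_permutation[OF ys] assms(3) by (auto intro: permutes_subset)
qed

text \<open>
  Take an arc \<open>x \<rightarrow> x'\<close> for which the set \<open>S\<close> of vertices reachable from \<open>x\<close> without it is
  smallest, and a vertex \<open>z\<close> of \<open>S\<close> farthest from \<open>x\<close>. An arc \<open>z \<rightarrow> w\<close> with \<open>w \<noteq> x\<close> is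
  redundant if \<open>z\<close> has another out-neighbour: without it \<open>z\<close> still reaches \<open>x\<close>, by the
  choice of \<open>S\<close>, and \<open>x\<close> still reaches \<open>w\<close>, by the choice of \<open>z\<close>.
\<close>

lemma minimal_strong_outdegree_one:
  assumes fin: "finite X" and D: "D \<subseteq> X \<times> X" and irr: "\<And>x. (x, x) \<notin> D"
    and st: "strong X D" and card: "card X \<ge> 2"
    and nonred: "\<And>x y. (x, y) \<in> D \<Longrightarrow> (x, y) \<notin> (D - {(x, y)})\<^sup>*"
  shows "\<exists>x\<in>X. \<exists>!y. (x, y) \<in> D"
proof (rule ccontr)
  assume no: "\<not> ?thesis"
  have ex1: "\<exists>y. (x, y) \<in> D" if "x \<in> X" for x
  proof (rule ccontr)
    assume "\<nexists>y. (x, y) \<in> D"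
    then have "{x} = X" using that by (intro strongD[OF st]) auto
    then have "card X = 1" by auto
    then show False using card by simp
  qed
  have ex2: "\<exists>y. (x, y) \<in> D \<and> y \<noteq> w" if "x \<in> X" for x w
    using ex1[OF that] no that by blast
  define R where "R x y = (D - {(x, y)})\<^sup>* `` {x}" for x y
  have RX: "R x y \<subseteq> X" if "x \<in> X" for x y
  proof
    fix z assume "z \<in> R x y"
    then have "(x, z) \<in> (D - {(x, y)})\<^sup>*" by (simp add: R_def)
    then show "z \<in> X" using that D by induction auto
  qed
  have Rstep: "w \<in> R x y" if "z \<in> R x y" "(z, w) \<in> D" "(z, w) \<noteq> (x, y)" for x y z w
    using that unfolding R_def by (auto intro: rtrancl_into_rtrancl)
  have Rself: "x \<in> R x y" for x y by (simp add: R_def)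
  obtain x0 where "x0 \<in> X" using card by (cases "X = {}") auto
  then obtain y0 where "(x0, y0) \<in> D" using ex1 by blast
  then obtain x y where xy: "(x, y) \<in> D"
    and min: "\<And>x' y'. (x', y') \<in> D \<Longrightarrow> card (R x y) \<le> card (R x' y')"
    using ex_has_least_nat[of "\<lambda>(x, y). (x, y) \<in> D" "(x0, y0)" "\<lambda>(x, y). card (R x y)"] by auto
  have xX: "x \<in> X" using xy D by auto
  let ?D = "D - {(x, y)}"
  define d where "d z = (LEAST n. (x, z) \<in> ?D ^^ n)" for z
  have d: "(x, z) \<in> ?D ^^ d z" if "z \<in> R x y" for z
  proof -
    have "\<exists>n. (x, z) \<in> ?D ^^ n" using that rtrancl_imp_relpow unfolding R_def by fastforce
    then show ?thesis unfolding d_def by (rule LeastI_ex)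
  qed
  have dle: "d z \<le> n" if "(x, z) \<in> ?D ^^ n" for z n
    unfolding d_def using that by (rule Least_le)
  have finR: "finite (R x y)" using RX[OF xX] fin finite_subset by blast
  \<comment> \<open>A second vertex of \<open>R x y\<close>, so that the farthest vertex cannot be
    \<open>x\<close> itself.\<close>
  obtain w0 where w0: "(x, w0) \<in> D" "w0 \<noteq> y" using ex2[OF xX] by blast
  have w0R: "w0 \<in> R x y" "w0 \<noteq> x" using Rstep[OF Rself w0(1)] w0 irr by auto
  obtain z where z: "z \<in> R x y" "\<And>v. v \<in> R x y \<Longrightarrow> d v \<le> d z"
  proof -
    have "Max (d ` R x y) \<in> d ` R x y" using finR w0R by (intro Max_in) auto
    then obtain z where "z \<in> R x y" "d z = Max (d ` R x y)" by auto
    then show ?thesis using that finR by auto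
  qed
  have dpos: "d v > 0" if "v \<in> R x y" "v \<noteq> x" for v
    using d[OF that(1)] that(2) by (cases "d v") auto
  have zx: "z \<noteq> x"
  proof
    assume "z = x"
    then have "d z \<le> 0" using dle[of x 0] by simp
    then show False using z(2)[OF w0R(1)] dpos[OF w0R] by simp
  qed
  have zX: "z \<in> X" using z(1) RX[OF xX] by blast
  obtain w where w: "(z, w) \<in> D" "w \<noteq> x" using ex2[OF zX] by blast
  have wR: "w \<in> R x y" using Rstep[OF z(1) w(1)] zx by auto
  \<comment> \<open>A walk from \<open>x\<close> with at most \<open>d z\<close> steps can be at
    \<open>z\<close> only at its end, so it never uses the arc \<open>(z, w)\<close>.\<close>
  have before: "(x, v) \<in> (D - {(z, w)})\<^sup>*" if "(x, v) \<in> ?D ^^ n" "n \<le> d z" for v n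
    using that
  proof (induction n arbitrary: v)
    case (Suc n)
    then obtain u where u: "(x, u) \<in> ?D ^^ n" "(u, v) \<in> ?D" by auto
    have "u \<noteq> z" using dle[OF u(1)] Suc.prems(2) by auto
    then have "(u, v) \<in> D - {(z, w)}" using u(2) by auto
    moreover have "(x, u) \<in> (D - {(z, w)})\<^sup>*" using Suc.IH u(1) Suc.prems(2) by simp
    ultimately show ?case by (rule rtrancl_into_rtrancl[rotated])
  qed auto
  have xw: "(x, w) \<in> (D - {(z, w)})\<^sup>*"
    using before[OF d[OF wR] z(2)[OF wR]] .
  have "x \<in> R z w"
  proof (rule ccontr)
    \<comment> \<open>In this case \<open>R z w\<close> lies inside \<open>R x y\<close> and misses
      \<open>x\<close>, against the minimal choice of \<open>R x y\<close>.\<close>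
    assume nx: "x \<notin> R z w"
    have "v \<in> R x y \<and> v \<noteq> x" if "(z, v) \<in> (D - {(z, w)})\<^sup>*" for v
      using that
    proof (induction)
      case base
      show ?case using z(1) zx by blast
    next
      case (step u v)
      then have "v \<in> R z w" unfolding R_def by (auto intro: rtrancl_into_rtrancl)
      moreover have "v \<in> R x y" using step Rstep by blast
      ultimately show ?case using nx by auto
    qed
    then have "R z w \<subset> R x y" using Rself[of x y] unfolding R_def by blast
    then have "card (R z w) < card (R x y)" using finR psubset_card_mono by blast
    then show False using min[OF w(1)] by simp
  qed
  then have "(z, w) \<in> (D - {(z, w)})\<^sup>*" using xw unfolding R_def by (auto intro: rtrancl_trans)
  then show False using nonred[OF w(1)] by blast
qed

section \<open>Contracting a perfect matching\<close>

text \<open>A matching is a function, so that switching it is composition with a permutation of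
  \<open>X\<close>; values outside \<open>X\<close> are unconstrained.\<close>

definition bip_matching :: "'a set \<Rightarrow> 'a set \<Rightarrow> 'a rel \<Rightarrow> ('a \<Rightarrow> 'a) \<Rightarrow> bool" where
  "bip_matching X Y E m \<longleftrightarrow> bij_betw m X Y \<and> (\<forall>x\<in>X. (x, m x) \<in> E)"

definition bip_covered :: "'a set \<Rightarrow> 'a set \<Rightarrow> 'a rel \<Rightarrow> bool" where
  "bip_covered X Y E \<longleftrightarrow> (\<forall>(x, y)\<in>E. \<exists>m. bip_matching X Y E m \<and> m x = y)"

text \<open>
  Orient all edges from \<open>X\<close> to \<open>Y\<close> and contract the edges of the matching \<open>m\<close>; the
  contracted edges remain as loops.
\<close>

definition contraction :: "'a set \<Rightarrow> 'a rel \<Rightarrow> ('a \<Rightarrow> 'a) \<Rightarrow> 'a rel" where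
  "contraction X E m = {(x, x'). x \<in> X \<and> x' \<in> X \<and> (x, m x') \<in> E}"

lemma contraction_subset: "contraction X E m \<subseteq> X \<times> X"
  by (auto simp: contraction_def)

lemma contraction_delete:
  assumes "inj_on m X" "x' \<in> X"
  shows "contraction X (E - {(x, m x')}) m = contraction X E m - {(x, x')}"
  using assms by (auto simp: contraction_def dest: inj_onD)

lemma matching_permute:
  assumes "bij_betw m X Y" "\<sigma> permutes X" "\<And>x. x \<in> X \<Longrightarrow> (x, m (\<sigma> x)) \<in> E"
  shows "bip_matching X Y E (m \<circ> \<sigma>)"
  using assms bij_betw_trans[OF permutes_imp_bij[OF assms(2)] assms(1)]
  by (auto simp: bip_matching_def)

text \<open>An edge \<open>(x, m x')\<close> is the arc from \<open>x\<close> to \<open>x'\<close>.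
  With a path from \<open>x'\<close> back to \<open>x\<close> it forms an alternating cycle, and
  switching \<open>m\<close> along that cycle produces a matching through the edge.\<close>

lemma covered_if_strong_contraction:
  assumes m: "bip_matching X Y E m" and E: "E \<subseteq> X \<times> Y"
    and st: "strong X (contraction X E m)"
  shows "bip_covered X Y E"
  unfolding bip_covered_def
proof clarify
  fix x y assume xy: "(x, y) \<in> E"
  have bij: "bij_betw m X Y" and mE: "\<And>x. x \<in> X \<Longrightarrow> (x, m x) \<in> E"
    using m by (auto simp: bip_matching_def)
  have x: "x \<in> X" and "y \<in> Y" using xy E by auto
  then obtain x' where x': "x' \<in> X" "m x' = y" using bij by (auto simp: bij_betw_def)
  have "(x', x) \<in> (contraction X E m)\<^sup>*"
    using strong_reachable[OF st contraction_subset x'(1) x] .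
  then obtain \<sigma> where \<sigma>: "\<sigma> permutes X" "\<sigma> x = x'"
    "\<And>u. u \<noteq> x \<Longrightarrow> \<sigma> u = u \<or> (u, \<sigma> u) \<in> contraction X E m"
    using reachable_closing_permutation[OF _ contraction_subset x'(1)] by metis
  have "(u, m (\<sigma> u)) \<in> E" if "u \<in> X" for u
    using \<sigma>(2) \<sigma>(3)[of u] mE[OF that] xy x'(2) by (cases "u = x") (auto simp: contraction_def)
  then have "bip_matching X Y E (m \<circ> \<sigma>)" using matching_permute bij \<sigma>(1) by metis
  then show "\<exists>m. bip_matching X Y E m \<and> m x = y" using \<sigma>(2) x'(2) by fastforce
qed

text \<open>An arc from \<open>x\<close> to \<open>x'\<close> is the walk from \<open>x\<close> over
  \<open>m x'\<close> to \<open>x'\<close>, so a set closed under undirected edges meets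
  \<open>X\<close> in a closed set of the contraction.\<close>

lemma connected_if_strong_contraction:
  assumes m: "bip_matching X Y E m" and E: "E \<subseteq> X \<times> Y"
    and st: "strong X (contraction X E m)"
  shows "strong (X \<union> Y) (E \<union> E\<inverse>)"
  unfolding strong_def
proof (intro allI impI)
  fix S assume S: "S \<subseteq> X \<union> Y" "S \<noteq> {}" "(E \<union> E\<inverse>) `` S \<subseteq> S"
  have Y: "Y = m ` X" and mE: "\<And>x. x \<in> X \<Longrightarrow> (x, m x) \<in> E"
    using m by (auto simp: bip_matching_def bij_betw_def)
  have 1: "u \<in> S" if "v \<in> S" "(v, u) \<in> E \<or> (u, v) \<in> E" for u v using S(3) that by blast
  have "S \<inter> X \<noteq> {}" using S(1,2) 1 mE Y by blast
  moreover have "contraction X E m `` (S \<inter> X) \<subseteq> S \<inter> X"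
    using 1 mE unfolding contraction_def by blast
  ultimately have "S \<inter> X = X" using strongD[OF st] by blast
  then have "X \<subseteq> S" by blast
  moreover then have "Y \<subseteq> S" using Y mE 1 by blast
  ultimately show "S = X \<union> Y" using S(1) by blast
qed

locale bip_mc =
  fixes X Y :: "'a set" and E :: "'a rel"
  assumes finX: "finite X" and disj: "X \<inter> Y = {}" and E: "E \<subseteq> X \<times> Y"
    and covered: "bip_covered X Y E"
    and conn: "strong (X \<union> Y) (E \<union> E\<inverse>)"
begin

lemma obtain_matching:
  assumes "(x, y) \<in> E"
  obtains m where "bip_matching X Y E m" "m x = y"
  using assms covered by (auto simp: bip_covered_def)

text \<open>If \<open>S\<close> is closed, all its neighbours are partners of \<open>S\<close> under
  \<open>m\<close>. By counting, every perfect matching pairs \<open>S\<close> with exactly these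
  partners, so an edge from outside \<open>S\<close> into them would lie in none. Hence no edge
  leaves \<open>S\<close> together with its partners.\<close>

lemma strong_contraction:
  assumes m: "bip_matching X Y E m"
  shows "strong X (contraction X E m)"
  unfolding strong_def
proof (intro allI impI)
  fix S assume S: "S \<subseteq> X" "S \<noteq> {}" "contraction X E m `` S \<subseteq> S"
  have inj: "inj_on m X" and Y: "Y = m ` X" and mE: "\<And>x. x \<in> X \<Longrightarrow> (x, m x) \<in> E"
    using m by (auto simp: bip_matching_def bij_betw_def)
  have out: "y \<in> m ` S" if "x \<in> S" "(x, y) \<in> E" for x y
  proof -
    have "y \<in> Y" using that E by auto
    then obtain x' where "x' \<in> X" "y = m x'" using Y by blast
    then have "(x, x') \<in> contraction X E m" using that S(1) by (auto simp: contraction_def)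
    then show ?thesis using S(3) that(1) \<open>y = m x'\<close> by blast
  qed
  have into: "x \<in> S" if xy: "(x, y) \<in> E" "y \<in> m ` S" for x y
  proof -
    obtain m' where m': "bip_matching X Y E m'" "m' x = y" using obtain_matching[OF xy(1)] .
    have inj': "inj_on m' X" and "\<And>x. x \<in> X \<Longrightarrow> (x, m' x) \<in> E"
      using m' by (auto simp: bip_matching_def bij_betw_def)
    then have "m' ` S \<subseteq> m ` S" using out S(1) by blast
    moreover have "card (m' ` S) = card (m ` S)"
      using inj inj' S(1) by (metis card_image inj_on_subset)
    moreover have "finite (m ` S)" using finX S(1) finite_subset by blast
    ultimately have "m' ` S = m ` S" by (meson card_subset_eq)
    then have "y \<in> m' ` S" using xy(2) by simp
    then obtain s where "s \<in> S" "m' s = y" by blast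
    then have "s = x" using inj' m'(2) S(1) xy(1) E by (auto dest: inj_onD)
    then show ?thesis using \<open>s \<in> S\<close> by blast
  qed
  have "S \<union> m ` S = X \<union> Y"
  proof (rule strongD[OF conn])
    show "S \<union> m ` S \<subseteq> X \<union> Y" using S(1) Y by blast
    show "S \<union> m ` S \<noteq> {}" using S(2) by blast
    have XY: "x \<in> X \<and> y \<in> Y" if "(x, y) \<in> E" for x y using that E by blast
    show "(E \<union> E\<inverse>) `` (S \<union> m ` S) \<subseteq> S \<union> m ` S"
      using out into XY S(1) disj Y by blast
  qed
  then show "S = X" using S(1) disj Y by blast
qed

end

locale bip_min_mc = bip_mc +
  assumes minimal: "\<And>x y. (x, y) \<in> E \<Longrightarrow> bip_covered X Y (E - {(x, y)}) \<Longrightarrow>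
    \<not> strong (X \<union> Y) ((E - {(x, y)}) \<union> (E - {(x, y)})\<inverse>)"
begin

text \<open>Otherwise the edge \<open>(x, m x')\<close> could be deleted: as
  \<open>x \<noteq> x'\<close> it is not in \<open>m\<close>, and a bypass keeps the contraction
  strong, hence the graph covered and connected.\<close>

lemma contraction_arc_needed:
  assumes m: "bip_matching X Y E m" and xx': "(x, x') \<in> contraction X E m" "x \<noteq> x'"
  shows "(x, x') \<notin> (contraction X E m - {(x, x')})\<^sup>*"
proof
  assume path: "(x, x') \<in> (contraction X E m - {(x, x')})\<^sup>*"
  let ?E = "E - {(x, m x')}"
  have inj: "inj_on m X" and x: "x \<in> X" "x' \<in> X" "(x, m x') \<in> E"
    using m xx' by (auto simp: bip_matching_def bij_betw_def contraction_def)
  have "strong X (contraction X E m - {(x, x')})"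
    using strong_delete_arc[OF strong_contraction[OF m] contraction_subset path] .
  then have st: "strong X (contraction X ?E m)" using contraction_delete[OF inj x(2)] by metis
  have m': "bip_matching X Y ?E m"
    using m inj x xx'(2) by (auto simp: bip_matching_def dest: inj_onD)
  have E': "?E \<subseteq> X \<times> Y" using E by blast
  show False
    using minimal[OF x(3)] covered_if_strong_contraction[OF m' E' st]
      connected_if_strong_contraction[OF m' E' st] by blast
qed

text \<open>If \<open>d\<close> were matched to another \<open>r\<close>, the path from
  \<open>c\<close> over \<open>a\<close> to \<open>r\<close> would bypass the arc from
  \<open>c\<close> to \<open>r\<close>.\<close>

lemma square_matching:
  assumes sq: "(a, b) \<in> E" "(a, d) \<in> E" "(c, b) \<in> E" "(c, d) \<in> E" and ne: "a \<noteq> c" "b \<noteq> d"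
    and m: "bip_matching X Y E m" "m a = b"
  shows "m c = d"
proof (rule ccontr)
  assume "m c \<noteq> d"
  have X: "a \<in> X" "c \<in> X" "d \<in> Y" using sq E by auto
  then obtain r where r: "r \<in> X" "m r = d" using m by (auto simp: bip_matching_def bij_betw_def)
  let ?D = "contraction X E m"
  have arcs: "(c, a) \<in> ?D" "(a, r) \<in> ?D" "(c, r) \<in> ?D"
    using X r m(2) sq by (auto simp: contraction_def)
  have "a \<noteq> r" "c \<noteq> r" using r m(2) ne \<open>m c \<noteq> d\<close> by auto
  then have "(c, a) \<in> ?D - {(c, r)}" "(a, r) \<in> ?D - {(c, r)}" using arcs ne by auto
  then have "(c, r) \<in> (?D - {(c, r)})\<^sup>*" by (meson r_into_rtrancl rtrancl_into_rtrancl)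
  then show False using contraction_arc_needed[OF m(1) arcs(3) \<open>c \<noteq> r\<close>] by blast
qed

text \<open>
  By the previous lemma a perfect matching contains both or none of two opposite edges of a
  square. Compare a matching \<open>m\<close> through \<open>ab\<close> and \<open>cd\<close> with a matching \<open>m'\<close> through an edge
  \<open>ay\<close> leaving the square: if \<open>c\<close> is not on the alternating cycle of \<open>a\<close>, switching along that
  cycle separates \<open>ab\<close> from \<open>cd\<close>; if it is, the cycle makes the arc from \<open>a\<close> to \<open>c\<close> redundant.
\<close>

lemma no_square_with_exit:
  assumes sq: "(a, b) \<in> E" "(a, d) \<in> E" "(c, b) \<in> E" "(c, d) \<in> E" and ne: "a \<noteq> c" "b \<noteq> d"
    and y: "(a, y) \<in> E" "y \<noteq> b" "y \<noteq> d"
  shows False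
proof -
  obtain m where m: "bip_matching X Y E m" "m a = b" using obtain_matching sq(1) by blast
  have mc: "m c = d" using square_matching[OF sq ne m] .
  obtain m' where m': "bip_matching X Y E m'" "m' a = y" using obtain_matching y(1) by blast
  have m'c: "m' c \<noteq> d"
    using square_matching[OF sq(4,3,2,1) ne[symmetric] m'(1)] m'(2) y by auto
  have X: "a \<in> X" "c \<in> X" using sq E by auto
  have bij: "bij_betw m X Y" "bij_betw m' X Y" and mE: "\<And>x. x \<in> X \<Longrightarrow> (x, m x) \<in> E"
    and m'E: "\<And>x. x \<in> X \<Longrightarrow> (x, m' x) \<in> E"
    using m m' by (auto simp: bip_matching_def)
  \<comment> \<open>The orbits of \<open>\<sigma>\<close> are the alternating cycles of
    \<open>m\<close> and \<open>m'\<close>, and \<open>Q\<close> below is the orbit of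
    \<open>a\<close>. The steps of \<open>\<sigma>\<close> are arcs of the contraction by
    \<open>m\<close>, since \<open>m (\<sigma> x) = m' x\<close>.\<close>
  define \<sigma> where "\<sigma> x = inv_into X m (m' x)" for x
  have \<sigma>: "\<sigma> x \<in> X" "m (\<sigma> x) = m' x" if "x \<in> X" for x
  proof -
    have "m' x \<in> m ` X" using that bij by (auto simp: bij_betw_def)
    then show "\<sigma> x \<in> X" "m (\<sigma> x) = m' x" unfolding \<sigma>_def by (auto intro: inv_into_into f_inv_into_f)
  qed
  define Q where "Q = {(x, \<sigma> x) | x. x \<in> X}\<^sup>* `` {a}"
  have Q\<sigma>: "\<sigma> x \<in> Q" if "x \<in> Q" "x \<in> X" for x
    using that unfolding Q_def by (auto intro: rtrancl_into_rtrancl)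
  have QX: "Q \<subseteq> X"
  proof
    fix z assume "z \<in> Q"
    then have "(a, z) \<in> {(x, \<sigma> x) | x. x \<in> X}\<^sup>*" by (simp add: Q_def)
    then show "z \<in> X" using X(1) \<sigma>(1) by induction auto
  qed
  have aQ: "a \<in> Q" by (simp add: Q_def)
  show False
  proof (cases "c \<in> Q")
    case False
    \<comment> \<open>Switching to \<open>m'\<close> on \<open>Q\<close> gives a matching again
      because \<open>m\<close> and \<open>m'\<close> have the same image on
      \<open>Q\<close>.\<close>
    define t where "t x = (if x \<in> Q then m' x else m x)" for x
    have inj: "inj_on m X" "inj_on m' X" using bij by (auto simp: bij_betw_def)
    have "m' ` Q \<subseteq> m ` Q" using Q\<sigma> QX \<sigma>(2) by (smt (verit) image_iff image_subsetI subsetD)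
    moreover have "card (m' ` Q) = card (m ` Q)"
      using inj QX by (metis card_image inj_on_subset)
    moreover have "finite (m ` Q)" using finX QX finite_subset by blast
    ultimately have eq: "m' ` Q = m ` Q" by (meson card_subset_eq)
    have "bij_betw t X Y"
    proof (rule bij_betw_imageI)
      show "inj_on t X"
      proof (rule inj_onI)
        fix u v assume uv: "u \<in> X" "v \<in> X" "t u = t v"
        have mix: False if "p \<in> Q" "q \<in> X" "q \<notin> Q" "m' p = m q" for p q
        proof -
          have "m q \<in> m ` Q" using eq that by (metis imageI)
          then show False using inj(1) that QX by (auto dest: inj_onD)
        qed
        show "u = v"
          using uv mix[of u v] mix[of v u] inj by (auto simp: t_def split: if_splits dest: inj_onD)
      qed
      have "t ` X = t ` Q \<union> t ` (X - Q)" using QX by blast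
      also have "\<dots> = m' ` Q \<union> m ` (X - Q)" by (auto simp: t_def)
      also have "\<dots> = m ` X" using eq QX by blast
      finally show "t ` X = Y" using bij by (auto simp: bij_betw_def)
    qed
    then have "bip_matching X Y E t" using mE m'E by (auto simp: bip_matching_def t_def)
    moreover have "t c = d" "t a = y" using False aQ mc m' by (auto simp: t_def)
    ultimately show False using square_matching[OF sq(4,3,2,1) ne[symmetric]] y by blast
  next
    case True
    let ?D = "contraction X E m"
    have ac: "(a, c) \<in> ?D" using X mc sq by (auto simp: contraction_def)
    \<comment> \<open>\<open>\<sigma>\<close> leaves \<open>a\<close> towards the partner of
      \<open>y\<close>, not towards \<open>c\<close>, so its path from \<open>a\<close> to
      \<open>c\<close> avoids the arc \<open>(a, c)\<close>.\<close>
    have "\<sigma> a \<noteq> c" using \<sigma>(2)[OF X(1)] mc m'(2) y by auto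
    then have "{(x, \<sigma> x) | x. x \<in> X} \<subseteq> ?D - {(a, c)}"
      using \<sigma> m'E by (auto simp: contraction_def)
    moreover have "(a, c) \<in> {(x, \<sigma> x) | x. x \<in> X}\<^sup>*" using True by (simp add: Q_def)
    ultimately have "(a, c) \<in> (?D - {(a, c)})\<^sup>*" using rtrancl_mono by blast
    then show False using contraction_arc_needed[OF m(1) ac ne(1)] by blast
  qed
qed

text \<open>With no exit from \<open>a\<close> or \<open>c\<close>, the set \<open>{a, c}\<close> is
  closed in the contraction and hence all of \<open>X\<close>. Only the 4-cycle survives, and the
  size bound removes it.\<close>

lemma no_square:
  assumes sq: "(a, b) \<in> E" "(a, d) \<in> E" "(c, b) \<in> E" "(c, d) \<in> E" and ne: "a \<noteq> c" "b \<noteq> d"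
    and card: "card X \<ge> 3"
  shows False
proof -
  have 1: "y = b \<or> y = d" if "(a, y) \<in> E" for y using no_square_with_exit[OF sq ne that] by blast
  have 2: "y = b \<or> y = d" if "(c, y) \<in> E" for y
    using no_square_with_exit[OF sq(3,4,1,2) ne(1)[symmetric] ne(2) that] by blast
  obtain m where m: "bip_matching X Y E m" "m a = b" using obtain_matching sq(1) by blast
  have mc: "m c = d" using square_matching[OF sq ne m] .
  have X: "a \<in> X" "c \<in> X" using sq E by auto
  have inj: "inj_on m X" using m by (auto simp: bip_matching_def bij_betw_def)
  have "{a, c} = X"
  proof (rule strongD[OF strong_contraction[OF m(1)]])
    show "contraction X E m `` {a, c} \<subseteq> {a, c}"
      using 1 2 m(2) mc inj X by (auto simp: contraction_def dest: inj_onD)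
  qed (use X in auto)
  then have "card X = 2" using ne(1) by (metis card_2_iff)
  then show False using card by simp
qed

text \<open>A vertex \<open>p\<close> whose only out-neighbour in the contraction, apart from its
  loop, is \<open>q\<close> has exactly the neighbours \<open>m p\<close> and
  \<open>m q\<close>.\<close>

lemma exists_degree_two:
  assumes card: "card X \<ge> 2"
  obtains p y1 y2 where "p \<in> X" "y1 \<noteq> y2" "E `` {p} = {y1, y2}"
proof -
  obtain e where "e \<in> E"
  proof -
    have "E \<noteq> {}"
    proof
      assume "E = {}"
      obtain x where x: "x \<in> X" using card by (cases "X = {}") auto
      then have "{x} = X \<union> Y" using \<open>E = {}\<close> by (intro strongD[OF conn]) auto
      then have "X = {x}" using x by blast
      then show False using card by simp
    qed
    then show ?thesis using that by blast
  qed
  then obtain m where m: "bip_matching X Y E m" using obtain_matching by (metis prod.exhaust)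
  let ?D = "contraction X E m - Id"
  have st: "strong X ?D"
    using strong_contraction[OF m] unfolding strong_def by blast
  have "(x, y) \<notin> (?D - {(x, y)})\<^sup>*" if "(x, y) \<in> ?D" for x y
  proof
    assume "(x, y) \<in> (?D - {(x, y)})\<^sup>*"
    moreover have "?D - {(x, y)} \<subseteq> contraction X E m - {(x, y)}" by blast
    ultimately have "(x, y) \<in> (contraction X E m - {(x, y)})\<^sup>*" using rtrancl_mono by blast
    then show False using contraction_arc_needed[OF m] that by blast
  qed
  then have "\<exists>x\<in>X. \<exists>!y. (x, y) \<in> ?D"
    using finX st card by (intro minimal_strong_outdegree_one) (auto simp: contraction_def)
  then obtain p q where p: "p \<in> X" "(p, q) \<in> ?D" "\<And>y. (p, y) \<in> ?D \<Longrightarrow> y = q" by blast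
  have bij: "inj_on m X" "m ` X = Y" and mE: "\<And>x. x \<in> X \<Longrightarrow> (x, m x) \<in> E"
    using m by (auto simp: bip_matching_def bij_betw_def)
  have q: "q \<in> X" "p \<noteq> q" "(p, m q) \<in> E" using p(1,2) by (auto simp: contraction_def)
  have "y \<in> {m p, m q}" if y: "(p, y) \<in> E" for y
  proof -
    obtain x where x: "x \<in> X" "y = m x" using y E bij(2) by blast
    show ?thesis using p(3)[of x] p(1) x y by (auto simp: contraction_def)
  qed
  then have "E `` {p} = {m p, m q}" using mE p(1) q by auto
  moreover have "m p \<noteq> m q" using bij p(1) q by (auto dest: inj_onD)
  ultimately show ?thesis using that p(1) by blast
qed

end

section \<open>Near-pencils\<close>

context
  fixes X Y :: "'a set" and E :: "'a rel"
  assumes E: "E \<subseteq> X \<times> Y"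
    and join: "\<And>x x'. x \<in> X \<Longrightarrow> x' \<in> X \<Longrightarrow> x \<noteq> x' \<Longrightarrow> \<exists>y. (x, y) \<in> E \<and> (x', y) \<in> E"
    and meet: "\<And>y y'. y \<in> Y \<Longrightarrow> y' \<in> Y \<Longrightarrow> y \<noteq> y' \<Longrightarrow> \<exists>x. (x, y) \<in> E \<and> (x, y') \<in> E"
    and no_sq: "\<And>x x' y y'. (x, y) \<in> E \<Longrightarrow> (x, y') \<in> E \<Longrightarrow> (x', y) \<in> E \<Longrightarrow> (x', y') \<in> E \<Longrightarrow>
      x = x' \<or> y = y'"
begin

text \<open>\<open>y1\<close> carries only the points \<open>p\<close> and \<open>r\<close>. Any
  other point is joined to \<open>p\<close> by \<open>y2\<close>, the only other line through
  \<open>p\<close>; any line other than \<open>y1\<close> and \<open>y2\<close> misses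
  \<open>p\<close> and so meets \<open>y1\<close> in \<open>r\<close>. Thus \<open>w\<close> is
  \<open>y2\<close>, and \<open>c x\<close> is the line joining the apex \<open>r\<close> to
  \<open>x\<close>.\<close>

lemma near_pencil_if_two_point_line:
  assumes p: "p \<in> X" "y1 \<noteq> y2" "E `` {p} = {y1, y2}"
    and r: "r \<noteq> p" "(r, y1) \<in> E" "\<And>x. x \<noteq> p \<Longrightarrow> (x, y1) \<in> E \<Longrightarrow> x = r"
  obtains r w c where "r \<in> X" "w \<in> Y" "bij_betw c (X - {r}) (Y - {w})"
    "E = (\<Union>x\<in>X - {r}. {(r, c x), (x, c x), (x, w)})"
proof -
  have inE: "x \<in> X \<and> y \<in> Y" if "(x, y) \<in> E" for x y using that E by blast
  have pE: "(p, y) \<in> E \<longleftrightarrow> y = y1 \<or> y = y2" for y using p(3) by blast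
  have y12: "y1 \<in> Y" "y2 \<in> Y" using pE E by blast+
  have rX: "r \<in> X" using r(2) E by blast
  have rw: "(r, y2) \<notin> E" using no_sq[of p y1 y2 r] pE r p(2) by blast
  have xw: "(x, y2) \<in> E" if x: "x \<in> X" "x \<noteq> r" for x
  proof (cases "x = p")
    case False
    then obtain y where "(x, y) \<in> E" "(p, y) \<in> E" using join[OF x(1) p(1)] by blast
    then show ?thesis using r(3)[OF False] pE[of y] x(2) by auto
  qed (use pE in simp)
  have ry: "(r, y) \<in> E" if y: "y \<in> Y" "y \<noteq> y2" for y
  proof (cases "y = y1")
    case False
    then obtain x where x: "(x, y) \<in> E" "(x, y1) \<in> E" using meet[OF y(1) y12(1)] by blast
    then have "x \<noteq> p" using pE False y by blast
    then show ?thesis using r(3) x by blast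
  qed (use r(2) in simp)
  define c where "c x = (SOME y. (r, y) \<in> E \<and> (x, y) \<in> E)" for x
  have c: "(r, c x) \<in> E" "(x, c x) \<in> E" if "x \<in> X" "x \<noteq> r" for x
  proof -
    have "\<exists>y. (r, y) \<in> E \<and> (x, y) \<in> E" using join[OF rX that(1)] that(2) by blast
    then have "(r, c x) \<in> E \<and> (x, c x) \<in> E" unfolding c_def by (rule someI_ex)
    then show "(r, c x) \<in> E" "(x, c x) \<in> E" by auto
  qed
  have ceq: "y = c x" if "(x, y) \<in> E" "x \<noteq> r" "y \<noteq> y2" for x y
    using no_sq[of x y "c x" r] c[of x] ry[of y] inE[OF that(1)] that by blast
  have cw: "c x \<noteq> y2" if "x \<in> X" "x \<noteq> r" for x using c[OF that] rw by auto
  have "bij_betw c (X - {r}) (Y - {y2})"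
  proof (rule bij_betw_imageI)
    show "inj_on c (X - {r})"
    proof (rule inj_onI)
      fix u v assume uv: "u \<in> X - {r}" "v \<in> X - {r}" "c u = c v"
      then have "(u, c u) \<in> E" "(v, c u) \<in> E" "(u, y2) \<in> E" "(v, y2) \<in> E" "c u \<noteq> y2"
        using c[of u] c[of v] xw cw by auto
      then show "u = v" using no_sq by blast
    qed
    show "c ` (X - {r}) = Y - {y2}"
    proof
      show "c ` (X - {r}) \<subseteq> Y - {y2}" using c cw inE by blast
      show "Y - {y2} \<subseteq> c ` (X - {r})"
      proof
        fix y assume y: "y \<in> Y - {y2}"
        then obtain x where x: "(x, y) \<in> E" "(x, y2) \<in> E" using meet[of y y2] y12 by blast
        then have "x \<noteq> r" "x \<in> X" using rw inE by auto
        then show "y \<in> c ` (X - {r})" using ceq[OF x(1)] y by blast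
      qed
    qed
  qed
  moreover have "E = (\<Union>x\<in>X - {r}. {(r, c x), (x, c x), (x, y2)})"
  proof
    show "(\<Union>x\<in>X - {r}. {(r, c x), (x, c x), (x, y2)}) \<subseteq> E" using c xw by auto
    show "E \<subseteq> (\<Union>x\<in>X - {r}. {(r, c x), (x, c x), (x, y2)})"
    proof clarify
      fix u y assume uy: "(u, y) \<in> E"
      have "\<exists>x\<in>X - {r}. (u, y) \<in> {(r, c x), (x, c x), (x, y2)}"
      proof (cases "u = r")
        case True
        then have "y \<in> Y - {y2}" using uy rw inE by auto
        then obtain x where "x \<in> X - {r}" "y = c x"
          using \<open>bij_betw c _ _\<close> by (auto simp: bij_betw_def)
        then show ?thesis using True by blast
      next
        case False
        then show ?thesis using ceq[OF uy] inE[OF uy] by auto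
      qed
      then show "(u, y) \<in> (\<Union>x\<in>X - {r}. {(r, c x), (x, c x), (x, y2)})" by blast
    qed
  qed
  ultimately show ?thesis using that rX y12(2) by blast
qed

text \<open>
  \<open>X\<close> and \<open>Y\<close> are the points and lines of a possibly degenerate projective plane, so a point
  on only two lines forces a near-pencil.
\<close>

lemma near_pencil:
  assumes p: "p \<in> X" "y1 \<noteq> y2" "E `` {p} = {y1, y2}" and card: "card Y \<ge> 3"
  obtains r w c where "r \<in> X" "w \<in> Y" "bij_betw c (X - {r}) (Y - {w})"
    "E = (\<Union>x\<in>X - {r}. {(r, c x), (x, c x), (x, w)})"
proof -
  have inE: "x \<in> X \<and> y \<in> Y" if "(x, y) \<in> E" for x y using that E by blast
  have pE: "(p, y) \<in> E \<longleftrightarrow> y = y1 \<or> y = y2" for y using p(3) by blast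
  have y12: "y1 \<in> Y" "y2 \<in> Y" using pE E by blast+
  \<comment> \<open>A third line misses \<open>p\<close>, so it meets \<open>y1\<close> and
    \<open>y2\<close> in points \<open>a\<close> and \<open>b\<close> other than
    \<open>p\<close>.\<close>
  obtain y3 where y3: "y3 \<in> Y" "y3 \<noteq> y1" "y3 \<noteq> y2"
  proof -
    have "card {y1, y2} < card Y" using card p(2) by simp
    then have "\<not> Y \<subseteq> {y1, y2}" by (meson card_mono finite.emptyI finite.insertI leD)
    then show ?thesis using that by blast
  qed
  obtain a where "(a, y3) \<in> E" and a2: "(a, y1) \<in> E"
    using meet[OF y3(1) y12(1) y3(2)] by blast
  then have a1: "a \<noteq> p" using y3 pE by blast
  note a = a1 a2
  obtain b where "(b, y3) \<in> E" and b2: "(b, y2) \<in> E"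
    using meet[OF y3(1) y12(2) y3(3)] by blast
  then have b1: "b \<noteq> p" using y3 pE by blast
  note b = b1 b2
  have split: "(x, y1) \<in> E \<or> (x, y2) \<in> E" if x: "x \<in> X" for x
  proof (cases "x = p")
    case False
    then obtain y where "(x, y) \<in> E" "(p, y) \<in> E" using join[OF x p(1)] by blast
    then show ?thesis using pE[of y] by auto
  qed (use pE in simp)
  have excl: False if "(x, y1) \<in> E" "(x, y2) \<in> E" "x \<noteq> p" for x
    using no_sq[of x y1 y2 p] that p(2) pE by blast
  \<comment> \<open>If both lines had a further point, \<open>a'\<close> and \<open>b'\<close>, the
    line through \<open>a\<close>, \<open>b\<close> and the line through \<open>a'\<close>,
    \<open>b'\<close> would meet in a point of \<open>y1\<close> or \<open>y2\<close>, forcing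
    \<open>a = a'\<close> or \<open>b = b'\<close>.\<close>
  have "(\<forall>x. x \<noteq> p \<longrightarrow> (x, y1) \<in> E \<longrightarrow> x = a) \<or> (\<forall>x. x \<noteq> p \<longrightarrow> (x, y2) \<in> E \<longrightarrow> x = b)"
  proof (rule ccontr)
    assume "\<not> ?thesis"
    then obtain a' b' where a': "a' \<noteq> p" "(a', y1) \<in> E" "a' \<noteq> a"
      and b': "b' \<noteq> p" "(b', y2) \<in> E" "b' \<noteq> b" by blast
    have "a \<noteq> b" "a' \<noteq> b'" using excl a b a' b' by blast+
    then obtain y y' where y: "(a, y) \<in> E" "(b, y) \<in> E" and y': "(a', y') \<in> E" "(b', y') \<in> E"
      using join inE a b a' b' by meson
    have ny: "y \<noteq> y1" "y \<noteq> y2" "y' \<noteq> y1" "y' \<noteq> y2" using y y' excl a b a' b' by blast+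
    have "y \<noteq> y'" using no_sq[of a y y1 a'] y y' a a' ny by blast
    then obtain x where x: "(x, y) \<in> E" "(x, y') \<in> E" using meet inE y y' by meson
    have "x = a \<and> x = a'" if "(x, y1) \<in> E"
      using no_sq[of x y y1 a] no_sq[of x y' y1 a'] that x y y' a a' ny by blast
    moreover have "x = b \<and> x = b'" if "(x, y2) \<in> E"
      using no_sq[of x y y2 b] no_sq[of x y' y2 b'] that x y y' b b' ny by blast
    ultimately show False using split inE x a' b' by blast
  qed
  then show ?thesis
  proof
    assume *: "\<forall>x. x \<noteq> p \<longrightarrow> (x, y1) \<in> E \<longrightarrow> x = a"
    show ?thesis
    proof (rule near_pencil_if_two_point_line[OF p a])
      show "x = a" if "x \<noteq> p" "(x, y1) \<in> E" for x using * that by blast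
    qed (rule that)
  next
    assume *: "\<forall>x. x \<noteq> p \<longrightarrow> (x, y2) \<in> E \<longrightarrow> x = b"
    have p': "E `` {p} = {y2, y1}" using p(3) by blast
    show ?thesis
    proof (rule near_pencil_if_two_point_line[OF p(1) p(2)[symmetric] p' b])
      show "x = b" if "x \<noteq> p" "(x, y2) \<in> E" for x using * that by blast
    qed (rule that)
  qed
qed

end

section \<open>Bounds on the spectral radius\<close>

definition neighbours :: "'a pair_pre_digraph \<Rightarrow> 'a \<Rightarrow> 'a set" (\<open>\<N>\<close>) where
  "\<N> G v = parcs G `` {v}"

lemma (in pair_graph) neighbours_sym: "u \<in> \<N> G v \<longleftrightarrow> v \<in> \<N> G u"
  using arcs_symmetric by (auto simp: neighbours_def)

lemma (in pair_graph) neighbours_subset: "\<N> G v \<subseteq> pverts G"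
  using in_arcsD2 by (auto simp: neighbours_def)

lemma (in pair_graph) finite_neighbours: "finite (\<N> G v)"
  using neighbours_subset pair_finite_verts finite_subset by blast

lemma (in pair_graph) sum_if_neighbours:
  "(\<Sum>u\<in>pverts G. if (v, u) \<in> parcs G then f u else 0) = sum f (\<N> G v)"
proof -
  have "(\<Sum>u\<in>pverts G. if (v, u) \<in> parcs G then f u else 0) =
      sum f {u \<in> pverts G. (v, u) \<in> parcs G}"
    using pair_finite_verts by (simp add: sum.inter_filter)
  also have "{u \<in> pverts G. (v, u) \<in> parcs G} = \<N> G v"
    using in_arcsD2 by (auto simp: neighbours_def)
  finally show ?thesis .
qed

lemma (in pair_graph) adjacency_symmetric:
  fixes f g :: "'a \<Rightarrow> real"
  shows "(\<Sum>v\<in>pverts G. f v * sum g (\<N> G v)) = (\<Sum>v\<in>pverts G. sum f (\<N> G v) * g v)"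
proof -
  have "(\<Sum>v\<in>pverts G. f v * sum g (\<N> G v)) =
      (\<Sum>v\<in>pverts G. \<Sum>u\<in>pverts G. if (v, u) \<in> parcs G then f v * g u else 0)"
    by (simp add: sum_if_neighbours[symmetric] sum_distrib_left if_distrib cong: if_cong)
  also have "\<dots> = (\<Sum>u\<in>pverts G. \<Sum>v\<in>pverts G. if (v, u) \<in> parcs G then f v * g u else 0)"
    by (rule sum.swap)
  also have "\<dots> = (\<Sum>u\<in>pverts G. \<Sum>v\<in>pverts G. if (u, v) \<in> parcs G then f v * g u else 0)"
    using arcs_symmetric by (intro sum.cong refl) auto
  also have "\<dots> = (\<Sum>v\<in>pverts G. sum f (\<N> G v) * g v)"
    by (simp add: sum_if_neighbours sum_distrib_right)
  finally show ?thesis .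
qed

lemma (in pair_graph) spectral_radius_subeigenvector:
  assumes "pverts G \<noteq> {}"
  obtains g :: "'a \<Rightarrow> real" where "\<And>v. g v \<ge> 0" "\<exists>v\<in>pverts G. g v > 0"
    "\<And>v. v \<in> pverts G \<Longrightarrow> \<rho> G * g v \<le> sum g (\<N> G v)" "\<rho> G \<ge> 0"
proof -
  obtain vs where vs: "set vs = pverts G" "distinct vs"
    using finite_distinct_list[OF pair_finite_verts] by blast
  let ?A = "adjacency_matrix G vs"
  have A: "?A \<in> carrier_mat (length vs) (length vs)" by (simp add: adjacency_matrix_def)
  have "length vs > 0" using vs assms by auto
  then have "\<rho> G \<in> norm ` spectrum ?A"
    using spectral_radius_mem_max(1)[OF A] graph_spectral_radius_eq[OF vs(2,1)] by simp
  then obtain k where k: "eigenvalue ?A k" "\<rho> G = norm k" by (auto simp: spectrum_def)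
  then obtain f where f: "\<exists>v\<in>pverts G. f v \<noteq> 0"
    "\<And>v. v \<in> pverts G \<Longrightarrow> sum f (\<N> G v) = k * f v"
    using eigenvalue_adjacency_matrix_iff[OF vs(2,1)] by (auto simp: sum_if_neighbours)
  show ?thesis
  proof (rule that[of "\<lambda>v. norm (f v)"])
    fix v assume "v \<in> pverts G"
    then have "\<rho> G * norm (f v) = norm (sum f (\<N> G v))" using f(2) k(2) by (simp add: norm_mult)
    also have "\<dots> \<le> (\<Sum>u\<in>\<N> G v. norm (f u))" by (rule norm_sum)
    finally show "\<rho> G * norm (f v) \<le> (\<Sum>u\<in>\<N> G v. norm (f u))" .
  qed (use f(1) k(2) in auto)
qed

lemma (in pair_graph) eigenvalue_le_spectral_radius:
  fixes f :: "'a \<Rightarrow> real"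
  assumes "\<exists>v\<in>pverts G. f v \<noteq> 0" "\<And>v. v \<in> pverts G \<Longrightarrow> sum f (\<N> G v) = k * f v"
  shows "k \<le> \<rho> G"
proof -
  obtain vs where vs: "set vs = pverts G" "distinct vs"
    using finite_distinct_list[OF pair_finite_verts] by blast
  let ?A = "adjacency_matrix G vs"
  have A: "?A \<in> carrier_mat (length vs) (length vs)" by (simp add: adjacency_matrix_def)
  have "length vs > 0" using vs assms by auto
  have "\<forall>v\<in>pverts G. (\<Sum>u\<in>\<N> G v. complex_of_real (f u)) = complex_of_real k * complex_of_real (f v)"
    using assms(2) by (metis of_real_mult of_real_sum)
  then have "eigenvalue ?A (complex_of_real k)"
    unfolding eigenvalue_adjacency_matrix_iff[OF vs(2,1)] sum_if_neighbours
    using assms(1) by (intro exI[of _ "\<lambda>v. complex_of_real (f v)"]) auto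
  then have "\<bar>k\<bar> \<in> norm ` spectrum ?A" by (force simp: spectrum_def)
  then have "\<bar>k\<bar> \<le> \<rho> G"
    using spectral_radius_mem_max(2)[OF A \<open>length vs > 0\<close>] graph_spectral_radius_eq[OF vs(2,1)]
    by simp
  then show ?thesis by simp
qed

text \<open>Where \<open>g\<close> vanishes, so does the sum of its nonnegative values on the
  neighbours; hence the zero set is closed.\<close>

lemma (in pair_graph) eigenvector_positive:
  fixes g :: "'a \<Rightarrow> real"
  assumes st: "strong (pverts G) (parcs G)" and g: "\<And>v. g v \<ge> 0" "\<exists>v\<in>pverts G. g v > 0"
    and eig: "\<And>v. v \<in> pverts G \<Longrightarrow> sum g (\<N> G v) = k * g v"
    and v: "v \<in> pverts G"
  shows "g v > 0"
proof (rule ccontr)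
  let ?Z = "{v \<in> pverts G. g v = 0}"
  assume "\<not> g v > 0"
  then have "g v = 0" using g(1)[of v] by simp
  then have "v \<in> ?Z" using v by simp
  moreover have "parcs G `` ?Z \<subseteq> ?Z"
  proof clarify
    fix u w assume uw: "(u, w) \<in> parcs G" "u \<in> pverts G" "g u = 0"
    have "sum g (\<N> G u) = 0" using eig[OF uw(2)] uw(3) by simp
    then have "\<forall>w\<in>\<N> G u. g w = 0" using finite_neighbours g(1) sum_nonneg_eq_0_iff by metis
    then show "w \<in> pverts G \<and> g w = 0" using uw(1) in_arcsD2 by (auto simp: neighbours_def)
  qed
  ultimately have "?Z = pverts G" by (intro strongD[OF st]) auto
  then show False using g(2) by force
qed

text \<open>Summing the inequality for \<open>g\<close> over all vertices counts each
  \<open>g v\<close> as often as the degree of \<open>v\<close>. In case of equality both termwise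
  estimates are tight: \<open>g\<close> is an eigenvector, hence positive, and every degree equals
  \<open>d\<close>.\<close>

lemma (in pair_graph) spectral_radius_le_max_degree:
  assumes ne: "pverts G \<noteq> {}" and deg: "\<And>v. v \<in> pverts G \<Longrightarrow> card (\<N> G v) \<le> d"
  shows "\<rho> G \<le> real d"
    and "strong (pverts G) (parcs G) \<Longrightarrow> \<rho> G = real d \<Longrightarrow> v \<in> pverts G \<Longrightarrow> card (\<N> G v) = d"
proof -
  obtain g where g: "\<And>v. g v \<ge> 0" "\<exists>v\<in>pverts G. g v > 0"
    "\<And>v. v \<in> pverts G \<Longrightarrow> \<rho> G * g v \<le> sum g (\<N> G v)"
    using spectral_radius_subeigenvector[OF ne] by metis
  let ?S = "sum g (pverts G)"
  have S: "?S > 0" using g(1,2) pair_finite_verts by (meson sum_pos2)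
  have "(\<Sum>v\<in>pverts G. \<rho> G * g v) \<le> (\<Sum>v\<in>pverts G. sum g (\<N> G v))" using g(3) by (rule sum_mono)
  also have T: "\<dots> = (\<Sum>v\<in>pverts G. real (card (\<N> G v)) * g v)"
    using adjacency_symmetric[of "\<lambda>_. 1" g] by simp
  finally have 1: "\<rho> G * ?S \<le> (\<Sum>v\<in>pverts G. real (card (\<N> G v)) * g v)"
    by (simp add: sum_distrib_left)
  have dg: "real (card (\<N> G v)) * g v \<le> real d * g v" if "v \<in> pverts G" for v
    using deg[OF that] g(1) by (intro mult_right_mono) auto
  then have 2: "(\<Sum>v\<in>pverts G. real (card (\<N> G v)) * g v) \<le> (\<Sum>v\<in>pverts G. real d * g v)"
    by (rule sum_mono)
  have 3: "(\<Sum>v\<in>pverts G. real d * g v) = real d * ?S" by (simp add: sum_distrib_left)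
  have "\<rho> G * ?S \<le> real d * ?S" using 1 2 3 by linarith
  then show "\<rho> G \<le> real d" using S by simp
  assume st: "strong (pverts G) (parcs G)" and eq: "\<rho> G = real d" and v: "v \<in> pverts G"
  have "(\<Sum>v\<in>pverts G. \<rho> G * g v) = (\<Sum>v\<in>pverts G. sum g (\<N> G v))"
    unfolding T sum_distrib_left[symmetric] using 1 2 3 eq by (metis antisym)
  then have "sum g (\<N> G v) = \<rho> G * g v" if "v \<in> pverts G" for v
    using sum_mono_inv[OF _ g(3) that pair_finite_verts] by fastforce
  then have pos: "g v > 0" using eigenvector_positive[OF st g(1,2) _ v] by blast
  have "(\<Sum>v\<in>pverts G. real (card (\<N> G v)) * g v) = (\<Sum>v\<in>pverts G. real d * g v)"
    using 1 2 3 eq by simp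
  then have "real (card (\<N> G v)) * g v = real d * g v"
    using sum_mono_inv[OF _ dg v pair_finite_verts] by fastforce
  then show "card (\<N> G v) = d" using pos by simp
qed

text \<open>
  The hypothesis says that the row sums of \<open>A\<^sup>2 - A\<close> are at most \<open>k\<close>. With \<open>g\<close> the entrywise
  modulus of an eigenvector for \<open>\<rho>\<close>, \<open>S\<close> the sum of \<open>g\<close> and \<open>T\<close> the sum of \<open>A g\<close>, this gives
  \<open>\<rho> T \<le> T + k S\<close>, while \<open>\<rho> S \<le> T\<close>.
\<close>

lemma (in pair_graph) spectral_radius_two_step_bound:
  assumes ne: "pverts G \<noteq> {}" and k: "k > 0"
    and two: "\<And>v. v \<in> pverts G \<Longrightarrow> (\<Sum>u\<in>\<N> G v. card (\<N> G u)) \<le> card (\<N> G v) + k"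
  shows "\<rho> G * \<rho> G \<le> \<rho> G + real k"
    and "strong (pverts G) (parcs G) \<Longrightarrow> \<rho> G * \<rho> G = \<rho> G + real k \<Longrightarrow> v \<in> pverts G \<Longrightarrow>
      (\<Sum>u\<in>\<N> G v. card (\<N> G u)) = card (\<N> G v) + k"
proof -
  obtain g where g: "\<And>v. g v \<ge> 0" "\<exists>v\<in>pverts G. g v > 0"
    "\<And>v. v \<in> pverts G \<Longrightarrow> \<rho> G * g v \<le> sum g (\<N> G v)" and \<rho>0: "\<rho> G \<ge> 0"
    using spectral_radius_subeigenvector[OF ne] by metis
  define d where "d v = real (card (\<N> G v))" for v
  have d0: "d v \<ge> 0" for v by (simp add: d_def)
  define S where "S = sum g (pverts G)"
  define T where "T = (\<Sum>v\<in>pverts G. d v * g v)"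
  \<comment> \<open>\<open>d\<close> holds the row sums of \<open>A\<close>, so
    \<open>sum d (\<N> G v)\<close> is a row sum of the square of \<open>A\<close>, and
    \<open>U\<close> is the sum of the entries of \<open>A\<close> applied twice to
    \<open>g\<close>.\<close>
  define U where "U = (\<Sum>v\<in>pverts G. sum d (\<N> G v) * g v)"
  have S: "S > 0" unfolding S_def using g(1,2) pair_finite_verts by (meson sum_pos2)
  have T: "T = (\<Sum>v\<in>pverts G. sum g (\<N> G v))"
    using adjacency_symmetric[of "\<lambda>_. 1" g] by (simp add: T_def d_def)
  have S': "(\<Sum>v\<in>pverts G. \<rho> G * g v) = \<rho> G * S" by (simp add: sum_distrib_left S_def)
  have "(\<Sum>v\<in>pverts G. \<rho> G * g v) \<le> (\<Sum>v\<in>pverts G. sum g (\<N> G v))" using g(3) by (rule sum_mono)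
  then have 1: "\<rho> G * S \<le> T" using S' T by simp
  have "\<rho> G * T = (\<Sum>v\<in>pverts G. d v * (\<rho> G * g v))"
    by (simp add: T_def sum_distrib_left algebra_simps)
  also have "\<dots> \<le> (\<Sum>v\<in>pverts G. d v * sum g (\<N> G v))"
    using g(3) d0 by (intro sum_mono mult_left_mono) auto
  also have "\<dots> = U" by (simp add: U_def adjacency_symmetric)
  finally have 2: "\<rho> G * T \<le> U" .
  have two': "sum d (\<N> G v) * g v \<le> (d v + real k) * g v" if "v \<in> pverts G" for v
  proof -
    have "sum d (\<N> G v) = real (\<Sum>u\<in>\<N> G v. card (\<N> G u))" by (simp add: d_def)
    also have "\<dots> \<le> real (card (\<N> G v) + k)" using two[OF that] by (simp only: of_nat_le_iff)
    finally show ?thesis using g(1) by (intro mult_right_mono) (auto simp: d_def)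
  qed
  then have "U \<le> (\<Sum>v\<in>pverts G. (d v + real k) * g v)" unfolding U_def by (rule sum_mono)
  also have TS: "\<dots> = T + real k * S"
    by (simp add: T_def S_def sum_distrib_left sum.distrib algebra_simps)
  finally have 3: "U \<le> T + real k * S" .
  show "\<rho> G * \<rho> G \<le> \<rho> G + real k"
  \<comment> \<open>The main estimate multiplies by \<open>\<rho> G - 1\<close>, which must be
    nonnegative; for small \<open>\<rho> G\<close> the claim is immediate.\<close>
  proof (cases "\<rho> G \<le> 1")
    case True
    have "\<rho> G * \<rho> G \<le> \<rho> G" using True \<rho>0 by (simp add: mult_left_le)
    then show ?thesis by simp
  next
    case False
    have "(\<rho> G - 1) * (\<rho> G * S) \<le> (\<rho> G - 1) * T" using 1 False by (intro mult_left_mono) auto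
    also have "\<dots> \<le> real k * S" using 2 3 by (simp add: algebra_simps)
    finally have "((\<rho> G - 1) * \<rho> G) * S \<le> real k * S" by (simp add: algebra_simps)
    then have "(\<rho> G - 1) * \<rho> G \<le> real k" using S by (metis mult_le_cancel_right_pos)
    then show ?thesis by (simp add: algebra_simps)
  qed
  assume st: "strong (pverts G) (parcs G)" and eq: "\<rho> G * \<rho> G = \<rho> G + real k"
    and v: "v \<in> pverts G"
  \<comment> \<open>Here \<open>k > 0\<close> enters. The factor \<open>\<rho> G - 1\<close> can
    then be cancelled, which gives \<open>T = \<rho> G * S\<close> and hence tightness at every
    vertex.\<close>
  have "\<rho> G > 1"
  proof (rule ccontr)
    assume "\<not> \<rho> G > 1"
    then have "\<rho> G * \<rho> G \<le> \<rho> G" using \<rho>0 by (simp add: mult_left_le)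
    then show False using eq k by simp
  qed
  have "(\<rho> G - 1) * T \<le> real k * S" using 2 3 by (simp add: algebra_simps)
  also have "real k = (\<rho> G - 1) * \<rho> G" using eq by (simp add: algebra_simps)
  finally have "(\<rho> G - 1) * T \<le> (\<rho> G - 1) * (\<rho> G * S)" by (simp only: mult.assoc)
  then have TS': "T = \<rho> G * S" using 1 \<open>\<rho> G > 1\<close> by simp
  then have "(\<Sum>v\<in>pverts G. \<rho> G * g v) = (\<Sum>v\<in>pverts G. sum g (\<N> G v))" using S' T by simp
  then have "sum g (\<N> G v) = \<rho> G * g v" if "v \<in> pverts G" for v
    using sum_mono_inv[OF _ g(3) that pair_finite_verts] by fastforce
  then have pos: "g v > 0" using eigenvector_positive[OF st g(1,2) _ v] by blast
  have "T + real k * S = \<rho> G * T"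
    using TS' eq by (simp add: algebra_simps flip: distrib_left mult.assoc)
  then have "U = (\<Sum>v\<in>pverts G. (d v + real k) * g v)" using 2 3 TS by simp
  then have "sum d (\<N> G v) * g v = (d v + real k) * g v"
    using sum_mono_inv[OF _ two' v pair_finite_verts] unfolding U_def by fastforce
  then have "sum d (\<N> G v) = d v + real k" using pos by simp
  then have "real (\<Sum>u\<in>\<N> G v. card (\<N> G u)) = real (card (\<N> G v) + k)" by (simp add: d_def)
  then show "(\<Sum>u\<in>\<N> G v. card (\<N> G u)) = card (\<N> G v) + k" by (simp only: of_nat_eq_iff)
qed

section \<open>Bipartite graphs\<close>

lemma (in pair_graph) connected_iff_strong:
  "Digraph_Component.connected (with_proj G) \<longleftrightarrow> pverts G \<noteq> {} \<and> strong (pverts G) (parcs G)"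
proof -
  have mk: "mk_symmetric (with_proj G) = G"
    using arcs_symmetric by (auto simp: mk_symmetric_def intro!: pair_pre_digraph.equality)
  have arcs: "parcs G \<subseteq> pverts G \<times> pverts G" using in_arcsD1 in_arcsD2 by auto
  have reach: "u \<rightarrow>\<^sup>*\<^bsub>with_proj G\<^esub> v \<longleftrightarrow> u \<in> pverts G \<and> (u, v) \<in> (parcs G)\<^sup>*" for u v
  proof
    assume "u \<rightarrow>\<^sup>*\<^bsub>with_proj G\<^esub> v"
    then have "(u, v) \<in> rtrancl_on (pverts G) (parcs G)" by (simp add: reachable_def)
    then show "u \<in> pverts G \<and> (u, v) \<in> (parcs G)\<^sup>*"
      by induction (auto intro: rtrancl_into_rtrancl)
  next
    assume *: "u \<in> pverts G \<and> (u, v) \<in> (parcs G)\<^sup>*"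
    then have "(u, v) \<in> (parcs G)\<^sup>*" by blast
    then have "(u, v) \<in> rtrancl_on (pverts G) (parcs G)"
      by induction (use * arcs in \<open>auto intro: rtrancl_on_into_rtrancl_on\<close>)
    then show "u \<rightarrow>\<^sup>*\<^bsub>with_proj G\<^esub> v" by (simp add: reachable_def)
  qed
  have st: "(\<forall>u\<in>pverts G. \<forall>v\<in>pverts G. (u, v) \<in> (parcs G)\<^sup>*) \<longleftrightarrow> strong (pverts G) (parcs G)"
  proof
    assume *: "\<forall>u\<in>pverts G. \<forall>v\<in>pverts G. (u, v) \<in> (parcs G)\<^sup>*"
    show "strong (pverts G) (parcs G)"
      unfolding strong_def
    proof (intro allI impI)
      fix S assume S: "S \<subseteq> pverts G" "S \<noteq> {}" "parcs G `` S \<subseteq> S"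
      then obtain u where u: "u \<in> S" by blast
      have "v \<in> S" if "(u, v) \<in> (parcs G)\<^sup>*" for v
        using that by induction (use u S(3) in auto)
      then show "S = pverts G" using * u S(1) by blast
    qed
  qed (simp add: strong_reachable[OF _ arcs])
  show ?thesis
    unfolding Digraph_Component.connected_def mk strongly_connected_def reach with_proj_simps
      st[symmetric] by blast
qed

locale bip_graph = pair_graph G for G :: "'a pair_pre_digraph" +
  fixes X Y :: "'a set" and E :: "'a rel"
  assumes verts: "pverts G = X \<union> Y" and disj: "X \<inter> Y = {}" and E: "E \<subseteq> X \<times> Y"
    and arcs: "parcs G = E \<union> E\<inverse>"
begin

lemma edges_eq: "edges G = {{x, y} | x y. (x, y) \<in> E}"
  unfolding edges_def arcs by (force simp: image_iff insert_commute)

lemma matching_function: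
  assumes M: "perfect_matching G M"
  shows "\<exists>m. bip_matching X Y E m \<and> (\<forall>x\<in>X. {x, m x} \<in> M)"
proof -
  have sub: "M \<subseteq> edges G" and pw: "pairwise disjnt M" and un: "\<Union> M = X \<union> Y"
    using M verts by (auto simp: perfect_matching_def matching_def)
  have e: "\<exists>x y. (x, y) \<in> E \<and> e = {x, y}" if "e \<in> M" for e using sub that edges_eq by blast
  have inE: "x \<in> X \<and> y \<in> Y" if "(x, y) \<in> E" for x y using that E by blast
  have same: "e = e'" if "e \<in> M" "e' \<in> M" "v \<in> e" "v \<in> e'" for e e' v
    using pw that by (auto simp: pairwise_def disjnt_def)
  have X: "\<exists>y. (x, y) \<in> E \<and> {x, y} \<in> M" if x: "x \<in> X" for x
  proof -
    obtain f where f: "f \<in> M" "x \<in> f" using un x by blast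
    obtain a b where ab: "(a, b) \<in> E" "f = {a, b}" using e[OF f(1)] by blast
    then have "x = a" using f inE disj x by blast
    then show ?thesis using f ab by blast
  qed
  have Y: "\<exists>x. (x, y) \<in> E \<and> {x, y} \<in> M" if y: "y \<in> Y" for y
  proof -
    obtain f where f: "f \<in> M" "y \<in> f" using un y by blast
    obtain a b where ab: "(a, b) \<in> E" "f = {a, b}" using e[OF f(1)] by blast
    then have "y = b" using f inE disj y by blast
    then show ?thesis using f ab by blast
  qed
  obtain m where m: "\<And>x. x \<in> X \<Longrightarrow> (x, m x) \<in> E \<and> {x, m x} \<in> M" using X by metis
  have "bij_betw m X Y"
  proof (rule bij_betw_imageI)
    show "inj_on m X"
    proof (rule inj_onI)
      fix u v assume uv: "u \<in> X" "v \<in> X" "m u = m v"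
      then have uvM: "{u, m u} \<in> M" "{v, m v} \<in> M" and "m v \<in> Y" using m inE by blast+
      have "{u, m u} = {v, m v}" by (rule same[OF uvM, of "m u"]) (use uv in auto)
      then have "u = v \<or> u = m v" by blast
      then show "u = v" using \<open>m v \<in> Y\<close> uv(1) disj by blast
    qed
    show "m ` X = Y"
    proof
      show "m ` X \<subseteq> Y" using m inE by blast
      show "Y \<subseteq> m ` X"
      proof
        fix y assume "y \<in> Y"
        then obtain x where x: "(x, y) \<in> E" "{x, y} \<in> M" using Y by blast
        then have "x \<in> X" using inE by blast
        then have "{x, m x} \<in> M" using m by blast
        then have "{x, m x} = {x, y}" by (rule same[OF _ x(2), of _ x]) auto
        then have "y = m x" by (metis doubleton_eq_iff)
        then show "y \<in> m ` X" using \<open>x \<in> X\<close> by blast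
      qed
    qed
  qed
  then show ?thesis using m by (auto simp: bip_matching_def)
qed

lemma perfect_matching_of_function:
  assumes m: "bip_matching X Y E m"
  shows "perfect_matching G ((\<lambda>x. {x, m x}) ` X)"
proof -
  have inj: "inj_on m X" and Y: "m ` X = Y" and mE: "\<And>x. x \<in> X \<Longrightarrow> (x, m x) \<in> E"
    using m by (auto simp: bip_matching_def bij_betw_def)
  have "(\<lambda>x. {x, m x}) ` X \<subseteq> edges G" using mE by (auto simp: edges_eq)
  moreover have "pairwise disjnt ((\<lambda>x. {x, m x}) ` X)"
    unfolding pairwise_def
  proof (intro ballI impI)
    fix e e' assume "e \<in> (\<lambda>x. {x, m x}) ` X" "e' \<in> (\<lambda>x. {x, m x}) ` X" and ne: "e \<noteq> e'"
    then obtain u v where uv: "u \<in> X" "v \<in> X" "e = {u, m u}" "e' = {v, m v}" by blast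
    then have "u \<noteq> v" "m u \<in> Y" "m v \<in> Y" using ne Y by blast+
    moreover have "m u \<noteq> m v" using inj_onD[OF inj _ uv(1,2)] \<open>u \<noteq> v\<close> by blast
    ultimately show "disjnt e e'" using uv disj by (auto simp: disjnt_def)
  qed
  moreover have "\<Union> ((\<lambda>x. {x, m x}) ` X) = pverts G" using Y verts by auto
  ultimately show ?thesis by (simp add: perfect_matching_def matching_def)
qed

lemma edge_in_perfect_matching_iff:
  assumes xy: "(x, y) \<in> E"
  shows "(\<exists>M. perfect_matching G M \<and> {x, y} \<in> M) \<longleftrightarrow> (\<exists>m. bip_matching X Y E m \<and> m x = y)"
proof
  assume "\<exists>M. perfect_matching G M \<and> {x, y} \<in> M"
  then obtain M where M: "perfect_matching G M" "{x, y} \<in> M" by blast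
  obtain m where m: "bip_matching X Y E m" "\<And>x. x \<in> X \<Longrightarrow> {x, m x} \<in> M"
    using matching_function[OF M(1)] by blast
  have "x \<in> X" using xy E by blast
  then have "{x, m x} \<in> M" using m(2) by blast
  moreover have "pairwise disjnt M" using M(1) by (simp add: perfect_matching_def matching_def)
  ultimately have "{x, m x} = {x, y}"
    using M(2) pairwiseD[of disjnt M "{x, m x}" "{x, y}"] by (auto simp: disjnt_def)
  then have "m x = y" by (metis doubleton_eq_iff)
  then show "\<exists>m. bip_matching X Y E m \<and> m x = y" using m(1) by blast
next
  assume "\<exists>m. bip_matching X Y E m \<and> m x = y"
  then obtain m where m: "bip_matching X Y E m" "m x = y" by blast
  have "x \<in> X" using xy E by blast
  then show "\<exists>M. perfect_matching G M \<and> {x, y} \<in> M"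
    using perfect_matching_of_function[OF m(1)] m(2) by blast
qed

lemma matching_covered_iff:
  "matching_covered G \<longleftrightarrow>
    card (X \<union> Y) \<ge> 2 \<and> strong (X \<union> Y) (E \<union> E\<inverse>) \<and> bip_covered X Y E"
proof -
  have "(\<forall>e\<in>edges G. \<exists>M. perfect_matching G M \<and> e \<in> M) \<longleftrightarrow>
      (\<forall>x y. (x, y) \<in> E \<longrightarrow> (\<exists>M. perfect_matching G M \<and> {x, y} \<in> M))"
    unfolding edges_eq by blast
  also have "\<dots> \<longleftrightarrow> bip_covered X Y E"
    using edge_in_perfect_matching_iff by (auto simp: bip_covered_def)
  finally show ?thesis
    unfolding matching_covered_def connected_iff_strong arcs verts by auto
qed

text \<open>Nothing says which of \<open>x\<close> and \<open>y\<close> lies in \<open>X\<close>, so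
  both orientations are removed from \<open>E\<close>.\<close>

lemma delete_edge_bip_graph:
  "bip_graph (delete_edge G {x, y}) X Y (E - {(x, y), (y, x)})"
proof
  have par: "parcs (delete_edge G {x, y}) = parcs G - {(x, y), (y, x)}"
    by (auto simp: delete_edge_def doubleton_eq_iff)
  have pv: "pverts (delete_edge G {x, y}) = pverts G" by (simp add: delete_edge_def)
  show "finite (pverts (delete_edge G {x, y}))" "finite (parcs (delete_edge G {x, y}))"
    using pair_finite_verts pair_finite_arcs by (auto simp: par pv)
  show "symmetric (with_proj (delete_edge G {x, y}))"
    using arcs_symmetric by (auto simp: symmetric_def par intro!: symI)
  show "fst e \<in> pverts (delete_edge G {x, y})" "snd e \<in> pverts (delete_edge G {x, y})"
      "fst e \<noteq> snd e"
    if "e \<in> parcs (delete_edge G {x, y})" for e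
    using that arc_fst_in_verts arc_snd_in_verts pair_no_loops by (auto simp: par pv)
  show "parcs (delete_edge G {x, y}) = E - {(x, y), (y, x)} \<union> (E - {(x, y), (y, x)})\<inverse>"
    unfolding par arcs by auto
qed (use verts disj E in \<open>auto simp: delete_edge_def\<close>)

lemma minimal_matching_coveredD:
  assumes "minimal_matching_covered G"
  shows "bip_min_mc X Y E"
proof
  have mc: "matching_covered G" and min: "\<And>e. e \<in> edges G \<Longrightarrow> \<not> matching_covered (delete_edge G e)"
    using assms by (auto simp: minimal_matching_covered_def)
  show "bip_covered X Y E" "strong (X \<union> Y) (E \<union> E\<inverse>)" using mc matching_covered_iff by auto
  show "finite X" using verts pair_finite_verts by simp
  fix x y assume xy: "(x, y) \<in> E" and cov: "bip_covered X Y (E - {(x, y)})"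
  interpret d: bip_graph "delete_edge G {x, y}" X Y "E - {(x, y), (y, x)}"
    by (rule delete_edge_bip_graph)
  have "(y, x) \<notin> E" using xy E disj by blast
  then have eq: "E - {(x, y), (y, x)} = E - {(x, y)}" by blast
  have "{x, y} \<in> edges G" using xy edges_eq by blast
  then have "\<not> matching_covered (delete_edge G {x, y})" using min by blast
  then show "\<not> strong (X \<union> Y) (E - {(x, y)} \<union> (E - {(x, y)})\<inverse>)"
    using d.matching_covered_iff cov mc matching_covered_iff unfolding eq by blast
qed (use disj E in auto)

end

lemma bipartite_bip_graph:
  assumes "pair_graph G" "bipartite G"
  obtains X Y E where "bip_graph G X Y E"
proof -
  interpret pair_graph G by fact
  obtain X Y where XY: "X \<union> Y = pverts G" "X \<inter> Y = {}" "parcs G \<subseteq> X \<times> Y \<union> Y \<times> X"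
    using assms(2) by (auto simp: bipartite_def)
  have "bip_graph G X Y (parcs G \<inter> X \<times> Y)"
    by unfold_locales (use XY arcs_symmetric in auto)
  then show ?thesis using that by blast
qed

text \<open>Connectivity with more than one vertex rules out \<open>E = {}\<close>, and a matching
  through any edge is a bijection between the sides.\<close>

lemma (in bip_mc) card_sides: "finite Y" "card X = card Y" if ne: "X \<union> Y \<noteq> {}" "card (X \<union> Y) \<noteq> 1"
proof -
  have "E \<noteq> {}"
  proof
    assume "E = {}"
    obtain x where x: "x \<in> X \<union> Y" using ne by blast
    then have "{x} = X \<union> Y" using \<open>E = {}\<close> by (intro strongD[OF conn]) auto
    then show False using ne by (metis card.empty card.insert_remove empty_Diff finite.emptyI One_nat_def)
  qed
  then obtain x y where "(x, y) \<in> E" by auto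
  then obtain m where "bip_matching X Y E m" using obtain_matching by blast
  then have "bij_betw m X Y" by (simp add: bip_matching_def)
  then show "finite Y" "card X = card Y"
    using finX bij_betw_finite bij_betw_same_card by blast+
qed

section \<open>Isomorphisms\<close>

text \<open>The map starts at \<open>H\<close> because the models \<open>P3_star\<close> and
  \<open>cycle_graph\<close> have explicit vertices on which it can be defined by cases; symmetry of
  isomorphism turns it around.\<close>

lemma graph_isomorphicI:
  assumes bij: "bij_betw h (pverts H) (pverts G)"
    and arcs: "parcs G = (\<lambda>(u, v). (h u, h v)) ` parcs H" "parcs H \<subseteq> pverts H \<times> pverts H"
  shows "G \<cong>\<^sub>G H"
proof -
  let ?f = "\<lparr>iso_verts = h, iso_arcs = (\<lambda>(u, v). (h u, h v)), iso_head = snd, iso_tail = fst\<rparr>"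
  have inj: "inj_on h (pverts H)" using bij by (simp add: bij_betw_def)
  have wf: "wf_digraph (with_proj H)"
    unfolding wf_digraph_wp_iff using arcs(2) by unfold_locales auto
  moreover have "inj_on (\<lambda>(u, v). (h u, h v)) (parcs H)"
  proof (rule inj_onI, clarify)
    fix u v u' v' assume "(u, v) \<in> parcs H" "(u', v') \<in> parcs H" "h u = h u'" "h v = h v'"
    moreover then have "u \<in> pverts H" "v \<in> pverts H" "u' \<in> pverts H" "v' \<in> pverts H"
      using arcs(2) by blast+
    ultimately show "u = u' \<and> v = v'" using inj by (auto dest: inj_onD)
  qed
  ultimately have "pre_digraph.digraph_isomorphism (with_proj H) ?f"
    using inj by (auto simp: pre_digraph.digraph_isomorphism_def)
  moreover have "with_proj G = app_iso ?f (with_proj H)"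
    using bij arcs(1) by (auto simp: app_iso_def with_proj_def bij_betw_def)
  ultimately have "H \<cong>\<^sub>G G" unfolding digraph_iso_def by blast
  then show ?thesis using digraph_iso_swap wf by blast
qed

lemma graph_isomorphicE:
  assumes "G \<cong>\<^sub>G H" "parcs G \<subseteq> pverts G \<times> pverts G"
  obtains h where "bij_betw h (pverts G) (pverts H)"
    "\<And>v. v \<in> pverts G \<Longrightarrow> \<N> H (h v) = h ` \<N> G v"
proof -
  obtain f where f: "pre_digraph.digraph_isomorphism (with_proj G) f"
    "with_proj H = app_iso f (with_proj G)"
    using assms(1) unfolding digraph_iso_def by blast
  have H: "pverts H = iso_verts f ` pverts G" "parcs H = iso_arcs f ` parcs G"
      "iso_tail f = fst" "iso_head f = snd"
    using arg_cong[OF f(2), of verts] arg_cong[OF f(2), of arcs] arg_cong[OF f(2), of tail]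
      arg_cong[OF f(2), of head] by simp_all
  have inj: "inj_on (iso_verts f) (pverts G)"
    using f(1) by (simp add: pre_digraph.digraph_isomorphism_def)
  \<comment> \<open>The arc map is a priori arbitrary; compatibility with tails and heads determines
    it on pairs.\<close>
  have arc: "iso_arcs f a = (iso_verts f (fst a), iso_verts f (snd a))" if "a \<in> parcs G" for a
    using f(1) that H(3,4) by (auto simp: pre_digraph.digraph_isomorphism_def prod_eq_iff)
  show ?thesis
  proof (rule that[of "iso_verts f"])
    show "bij_betw (iso_verts f) (pverts G) (pverts H)" using inj H(1) by (simp add: bij_betw_def)
    fix v assume v: "v \<in> pverts G"
    have par: "parcs H = (\<lambda>a. (iso_verts f (fst a), iso_verts f (snd a))) ` parcs G"
      using H(2) arc by simp
    show "\<N> H (iso_verts f v) = iso_verts f ` \<N> G v"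
    proof
      show "\<N> H (iso_verts f v) \<subseteq> iso_verts f ` \<N> G v"
      proof
        fix w assume "w \<in> \<N> H (iso_verts f v)"
        then obtain a b where ab: "(a, b) \<in> parcs G" "iso_verts f v = iso_verts f a"
            "w = iso_verts f b"
          unfolding neighbours_def par by auto
        have "a \<in> pverts G" using ab(1) assms(2) by blast
        then have "v = a" using inj_onD[OF inj ab(2) v] by blast
        then show "w \<in> iso_verts f ` \<N> G v" using ab by (auto simp: neighbours_def)
      qed
      show "iso_verts f ` \<N> G v \<subseteq> \<N> H (iso_verts f v)"
        unfolding neighbours_def par by force
    qed
  qed
qed

text \<open>The eigenvector is pulled back along the isomorphism. For the extremal graphs a lower
  bound suffices, because the upper bound is already available.\<close>

lemma spectral_radius_ge_isomorphic:
  fixes f :: "'b \<Rightarrow> real"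
  assumes G: "pair_graph G" and iso: "G \<cong>\<^sub>G H"
    and f: "\<exists>v\<in>pverts H. f v \<noteq> 0" "\<And>v. v \<in> pverts H \<Longrightarrow> sum f (\<N> H v) = k * f v"
  shows "k \<le> \<rho> G"
proof -
  interpret pair_graph G by fact
  have "parcs G \<subseteq> pverts G \<times> pverts G" using in_arcsD1 in_arcsD2 by auto
  then obtain h where h: "bij_betw h (pverts G) (pverts H)"
    "\<And>v. v \<in> pverts G \<Longrightarrow> \<N> H (h v) = h ` \<N> G v"
    using graph_isomorphicE[OF iso] by blast
  show ?thesis
  proof (rule eigenvalue_le_spectral_radius[of "f \<circ> h"])
    show "\<exists>v\<in>pverts G. (f \<circ> h) v \<noteq> 0" 
    proof -
      obtain w where "w \<in> pverts H" "f w \<noteq> 0" using f(1) by blast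
      moreover have "h ` pverts G = pverts H" using h(1) by (simp add: bij_betw_def)
      ultimately show ?thesis by force
    qed
    fix v assume v: "v \<in> pverts G"
    have "inj_on h (\<N> G v)" using h(1) neighbours_subset using inj_on_subset[OF bij_betw_imp_inj_on] by blast
    then have "sum (f \<circ> h) (\<N> G v) = sum f (\<N> H (h v))" using h(2)[OF v] by (simp add: sum.reindex)
    also have "\<dots> = k * f (h v)" using f(2) bij_betwE[OF h(1)] v by blast
    finally show "sum (f \<circ> h) (\<N> G v) = k * (f \<circ> h) v" by simp
  qed
qed

section \<open>Extremal graphs\<close>

lemma (in bip_graph) bip_graph_swap: "bip_graph G Y X (E\<inverse>)"
  by unfold_locales (use verts disj E arcs in auto)

lemma (in bip_graph) neighbours_left:
  assumes "x \<in> X"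
  shows "\<N> G x = E `` {x}" and "\<N> G x \<subseteq> Y"
  using assms E disj by (auto simp: neighbours_def arcs)

text \<open>Stated through neighbourhoods of arbitrary vertices, so that it is unchanged when the
  two sides are exchanged.\<close>

definition square_free :: "'a pair_pre_digraph \<Rightarrow> bool" where
  "square_free G \<longleftrightarrow> (\<forall>u u' v v'. v \<in> \<N> G u \<inter> \<N> G u' \<longrightarrow> v' \<in> \<N> G u \<inter> \<N> G u' \<longrightarrow> u = u' \<or> v = v')"

text \<open>The sum counts walks of length two from \<open>v\<close>: one return to \<open>v\<close>
  per neighbour and, without squares, at most one walk to each other vertex of \<open>X\<close>.
  Equality means that all of them are reached.\<close>

lemma (in bip_graph) two_step_left:
  assumes sf: "square_free G" and v: "v \<in> X"
  shows "(\<Sum>u\<in>\<N> G v. card (\<N> G u)) \<le> card (\<N> G v) + (card X - 1)"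
    and "(\<Sum>u\<in>\<N> G v. card (\<N> G u)) = card (\<N> G v) + (card X - 1) \<Longrightarrow> x \<in> X \<Longrightarrow> x \<noteq> v \<Longrightarrow>
      \<exists>u. u \<in> \<N> G v \<and> u \<in> \<N> G x"
proof -
  interpret s: bip_graph G Y X "E\<inverse>" by (rule bip_graph_swap)
  let ?W = "\<Union>u\<in>\<N> G v. \<N> G u - {v}"
  have card_u: "card (\<N> G u) = 1 + card (\<N> G u - {v})" if "u \<in> \<N> G v" for u
  proof -
    have "v \<in> \<N> G u" using that neighbours_sym by blast
    then show ?thesis using card.remove[OF finite_neighbours] by simp
  qed
  have W_card: "card ?W = (\<Sum>u\<in>\<N> G v. card (\<N> G u - {v}))"
  proof (rule card_UN_disjoint)
    show "\<forall>i\<in>\<N> G v. \<forall>j\<in>\<N> G v. i \<noteq> j \<longrightarrow> (\<N> G i - {v}) \<inter> (\<N> G j - {v}) = {}"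
    proof (intro ballI impI equals0I)
      fix i j w assume ij: "i \<in> \<N> G v" "j \<in> \<N> G v" "i \<noteq> j" and w: "w \<in> (\<N> G i - {v}) \<inter> (\<N> G j - {v})"
      then have "i \<in> \<N> G v \<inter> \<N> G w" "j \<in> \<N> G v \<inter> \<N> G w" using neighbours_sym by blast+
      then show False using sf ij(3) w unfolding square_free_def by blast
    qed
  qed (auto simp: finite_neighbours)
  have "(\<Sum>u\<in>\<N> G v. card (\<N> G u)) = (\<Sum>u\<in>\<N> G v. 1 + card (\<N> G u - {v}))"
    using card_u by (rule sum.cong[OF refl])
  also have "\<dots> = card (\<N> G v) + (\<Sum>u\<in>\<N> G v. card (\<N> G u - {v}))" by (simp only: sum.distrib) simp
  finally have sum: "(\<Sum>u\<in>\<N> G v. card (\<N> G u)) = card (\<N> G v) + card ?W" using W_card by simp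
  have W: "?W \<subseteq> X - {v}"
  proof
    fix x assume "x \<in> ?W"
    then obtain u where u: "u \<in> \<N> G v" "x \<in> \<N> G u" "x \<noteq> v" by blast
    have "u \<in> Y" using u(1) neighbours_left(2)[OF v] by blast
    then show "x \<in> X - {v}" using u s.neighbours_left(2) by blast
  qed
  have fin: "finite (X - {v})" using pair_finite_verts verts by simp
  have cX: "card (X - {v}) = card X - 1" using v by simp
  show "(\<Sum>u\<in>\<N> G v. card (\<N> G u)) \<le> card (\<N> G v) + (card X - 1)"
    using sum card_mono[OF fin W] cX by simp
  assume "(\<Sum>u\<in>\<N> G v. card (\<N> G u)) = card (\<N> G v) + (card X - 1)" and x: "x \<in> X" "x \<noteq> v"
  then have "card ?W = card (X - {v})" using sum cX by simp
  then have "?W = X - {v}" using card_subset_eq[OF fin W] by blast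
  then have "x \<in> ?W" using x by blast
  then show "\<exists>u. u \<in> \<N> G v \<and> u \<in> \<N> G x" using neighbours_sym by blast
qed

lemma P3_star_simps:
  "pverts (P3_star k) = {Left_End, Right_End} \<union> Inner_Left ` {..<k} \<union> Inner_Right ` {..<k}"
  "parcs (P3_star k) = (\<Union>i<k. {(Left_End, Inner_Left i), (Inner_Left i, Inner_Right i),
     (Inner_Right i, Right_End), (Inner_Left i, Left_End), (Inner_Right i, Inner_Left i),
     (Right_End, Inner_Right i)})"
  by (auto simp: P3_star_def Let_def)

lemma P3_star_neighbours:
  "\<N> (P3_star k) Left_End = Inner_Left ` {..<k}"
  "\<N> (P3_star k) Right_End = Inner_Right ` {..<k}"
  "i < k \<Longrightarrow> \<N> (P3_star k) (Inner_Left i) = {Left_End, Inner_Right i}"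
  "i < k \<Longrightarrow> \<N> (P3_star k) (Inner_Right i) = {Right_End, Inner_Left i}"
  by (auto simp: neighbours_def P3_star_simps)

lemma P3_star_isomorphic_spectral_radius_ge:
  assumes "pair_graph G" "G \<cong>\<^sub>G P3_star k" and l: "l * l = l + real k" and k: "k > 0"
  shows "l \<le> \<rho> G"
proof -
  \<comment> \<open>An eigenvector for \<open>l\<close>: at an end the equation is
    \<open>k = l * (l - 1)\<close>, at an inner vertex \<open>(l - 1) + 1 = l\<close>.\<close>
  define f where "f v = (case v of Left_End \<Rightarrow> l - 1 | Right_End \<Rightarrow> l - 1 | _ \<Rightarrow> 1)" for v
  have f: "f Left_End = l - 1" "f Right_End = l - 1" "f (Inner_Left i) = 1" "f (Inner_Right i) = 1"
    for i by (simp_all add: f_def)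
  have inj: "inj_on Inner_Left A" "inj_on Inner_Right A" for A by (auto intro: inj_onI)
  show ?thesis
  proof (rule spectral_radius_ge_isomorphic[OF assms(1,2), of f])
    show "\<exists>v\<in>pverts (P3_star k). f v \<noteq> 0"
      using k by (intro bexI[of _ "Inner_Left 0"]) (auto simp: f P3_star_simps)
    fix v assume "v \<in> pverts (P3_star k)"
    then consider "v = Left_End" | "v = Right_End" | i where "i < k" "v = Inner_Left i"
      | i where "i < k" "v = Inner_Right i"
      by (auto simp: P3_star_simps)
    then show "sum f (\<N> (P3_star k) v) = l * f v"
      by cases (use l in \<open>auto simp: P3_star_neighbours f sum.reindex[OF inj(1)] sum.reindex[OF inj(2)]
          algebra_simps\<close>)
  qed
qed

text \<open>Each \<open>x\<close> other than \<open>r\<close> contributes the path from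
  \<open>r\<close> over \<open>c x\<close> and \<open>x\<close> to \<open>w\<close>.\<close>

lemma (in bip_graph) near_pencil_isomorphic:
  assumes r: "r \<in> X" and w: "w \<in> Y" and c: "bij_betw c (X - {r}) (Y - {w})"
    and E_eq: "E = (\<Union>x\<in>X - {r}. {(r, c x), (x, c x), (x, w)})"
  shows "G \<cong>\<^sub>G P3_star (card X - 1)"
proof -
  have "finite (X - {r})" "card (X - {r}) = card X - 1"
    using pair_finite_verts verts r by auto
  then obtain e where e: "bij_betw e {..<card X - 1} (X - {r})"
    using ex_bij_betw_nat_finite by (metis lessThan_atLeast0)
  let ?k = "card X - 1"
  define h where "h v = (case v of Left_End \<Rightarrow> r | Right_End \<Rightarrow> w | Inner_Left i \<Rightarrow> c (e i)
    | Inner_Right i \<Rightarrow> e i)" for v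
  have h: "h Left_End = r" "h Right_End = w" "h (Inner_Left i) = c (e i)" "h (Inner_Right i) = e i"
    for i by (simp_all add: h_def)
  have e_im: "e ` {..<?k} = X - {r}" and e_inj: "inj_on e {..<?k}"
    and c_im: "c ` (X - {r}) = Y - {w}" and c_inj: "inj_on c (X - {r})"
    using e c by (auto simp: bij_betw_def)
  have ce_im: "(\<lambda>i. c (e i)) ` {..<?k} = Y - {w}" using e_im c_im by (metis image_image)
  have ce_inj: "inj_on (\<lambda>i. c (e i)) {..<?k}"
    using comp_inj_on[OF e_inj] c_inj e_im by (simp add: comp_def)
  have eX: "e i \<in> X" "e i \<noteq> r" "c (e i) \<in> Y" "c (e i) \<noteq> w" if "i < ?k" for i
    using e_im ce_im that by blast+
  have xy: "x \<noteq> y" if "x \<in> X" "y \<in> Y" for x y using that disj by blast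
  show ?thesis
  proof (rule graph_isomorphicI[of h])
    show "bij_betw h (pverts (P3_star ?k)) (pverts G)"
    proof (rule bij_betw_imageI)
      have "h ` pverts (P3_star ?k) = {r, w} \<union> (\<lambda>i. c (e i)) ` {..<?k} \<union> e ` {..<?k}"
        by (simp add: P3_star_simps image_Un image_image h)
      then show "h ` pverts (P3_star ?k) = pverts G" using ce_im e_im r w verts by auto
      show "inj_on h (pverts (P3_star ?k))"
      proof (rule inj_onI)
        fix u v assume uv: "u \<in> pverts (P3_star ?k)" "v \<in> pverts (P3_star ?k)" "h u = h v"
        show "u = v"
          using uv eX xy xy[THEN not_sym] r w inj_onD[OF e_inj] inj_onD[OF ce_inj]
          by (cases u; cases v; simp add: P3_star_simps h image_iff; metis)
      qed
    qed
    have "E = (\<Union>i<?k. {(r, c (e i)), (e i, c (e i)), (e i, w)})"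
      unfolding E_eq e_im[symmetric] by simp
    then show "parcs G = (\<lambda>(u, v). (h u, h v)) ` parcs (P3_star ?k)"
      unfolding arcs P3_star_simps image_UN by (auto simp: h)
    show "parcs (P3_star ?k) \<subseteq> pverts (P3_star ?k) \<times> pverts (P3_star ?k)"
      by (auto simp: P3_star_simps)
  qed
qed

lemma cycle_graph_4:
  "pverts (cycle_graph 4) = {0, 1, 2, 3}"
  "parcs (cycle_graph 4) = {(0, 1), (1, 0), (1, 2), (2, 1), (2, 3), (3, 2), (3, 0), (0, 3)}"
proof -
  have "{..<4::nat} = {0, 1, 2, 3}" by auto
  then show "pverts (cycle_graph 4) = {0, 1, 2, 3}"
    "parcs (cycle_graph 4) = {(0, 1), (1, 0), (1, 2), (2, 1), (2, 3), (3, 2), (3, 0), (0, 3)}"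
    by (auto simp: cycle_graph_def numeral_2_eq_2[symmetric] numeral_3_eq_3[symmetric])
qed

lemma cycle_graph_4_isomorphic_spectral_radius_ge:
  assumes "pair_graph G" "G \<cong>\<^sub>G cycle_graph 4"
  shows "2 \<le> \<rho> G"
proof (rule spectral_radius_ge_isomorphic[OF assms, of "\<lambda>_. 1"])
  fix v assume "v \<in> pverts (cycle_graph 4)"
  then have "\<N> (cycle_graph 4) v = (if even v then {1, 3} else {0, 2})"
    by (auto simp: cycle_graph_4 neighbours_def)
  then show "(\<Sum>u\<in>\<N> (cycle_graph 4) v. 1) = 2 * (1::real)" by simp
qed (auto simp: cycle_graph_4)

lemma (in bip_graph) complete_isomorphic_cycle_graph_4:
  assumes "card X = 2" "card Y = 2" "E = X \<times> Y"
  shows "G \<cong>\<^sub>G cycle_graph 4"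
proof -
  obtain a b c d where ab: "X = {a, b}" "a \<noteq> b" and cd: "Y = {c, d}" "c \<noteq> d"
    using assms by (auto simp: card_2_iff)
  define h where "h i = (if i = 0 then a else if i = 1 then c else if i = 2 then b else d)" for i :: nat
  have ne: "a \<noteq> c" "a \<noteq> d" "b \<noteq> c" "b \<noteq> d" using disj ab cd by auto
  show ?thesis
  proof (rule graph_isomorphicI[of h])
    show "bij_betw h (pverts (cycle_graph 4)) (pverts G)"
      using ne ab cd by (auto simp: bij_betw_def inj_on_def cycle_graph_4 verts h_def)
    show "parcs G = (\<lambda>(u, v). (h u, h v)) ` parcs (cycle_graph 4)"
      unfolding arcs assms(3) ab cd cycle_graph_4 by (auto simp: h_def)
    show "parcs (cycle_graph 4) \<subseteq> pverts (cycle_graph 4) \<times> pverts (cycle_graph 4)"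
      by (auto simp: cycle_graph_4)
  qed
qed

theorem theorem1p1:
  fixes G :: "'a pair_pre_digraph" and n :: nat
  assumes "pair_graph G"
    and "bipartite G"
    and "minimal_matching_covered G"
    and "card (pverts G) = n"
  shows "(n \<le> 4 \<longrightarrow> \<rho> G \<le> 2 \<and> (\<rho> G = 2 \<longleftrightarrow> G \<cong>\<^sub>G cycle_graph 4)) \<and>
    (n \<ge> 6 \<longrightarrow> \<rho> G \<le> (1 + sqrt (2 * real n - 3)) / 2 \<and>
      (\<rho> G = (1 + sqrt (2 * real n - 3)) / 2 \<longleftrightarrow> G \<cong>\<^sub>G P3_star ((n - 2) div 2)))"
proof -
  obtain X Y E where "bip_graph G X Y E" using bipartite_bip_graph assms(1,2) by blast
  then interpret bip_graph G X Y E .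
  interpret s: bip_graph G Y X "E\<inverse>" by (rule bip_graph_swap)
  interpret m: bip_min_mc X Y E using minimal_matching_coveredD assms(3) by blast
  have "matching_covered G" using assms(3) by (simp add: minimal_matching_covered_def)
  then have card2: "card (X \<union> Y) \<ge> 2" and st: "strong (pverts G) (parcs G)"
    using matching_covered_iff verts arcs by auto
  have ne: "X \<union> Y \<noteq> {}" "pverts G \<noteq> {}" using card2 verts by auto
  have "card (X \<union> Y) \<noteq> 1" using card2 by simp
  then have finY: "finite Y" and card_eq: "card X = card Y" using m.card_sides ne(1) by auto
  have n: "n = 2 * card X"
    using assms(4) verts card_Un_disjoint[OF m.finX finY disj] card_eq by simp
  have deg: "card (\<N> G v) \<le> card X" if "v \<in> pverts G" for v
    using that neighbours_left(2) s.neighbours_left(2) card_mono finY m.finX card_eq verts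
    by (metis UnE)
  \<comment> \<open>Each side has at most two vertices, so degrees are at most 2; if
    \<open>\<rho> G = 2\<close>, all degrees are 2 and the graph is complete bipartite.\<close>
  have small: "\<rho> G \<le> 2 \<and> (\<rho> G = 2 \<longleftrightarrow> G \<cong>\<^sub>G cycle_graph 4)" if "n \<le> 4"
  proof -
    have deg2: "card (\<N> G v) \<le> 2" if "v \<in> pverts G" for v using deg[OF that] n \<open>n \<le> 4\<close> by simp
    have le: "\<rho> G \<le> 2" using spectral_radius_le_max_degree(1)[OF ne(2) deg2] by simp
    have "G \<cong>\<^sub>G cycle_graph 4" if eq: "\<rho> G = 2"
    proof -
      have full: "card (\<N> G v) = 2" if "v \<in> pverts G" for v
        using spectral_radius_le_max_degree(2)[OF ne(2) deg2 st _ that] eq by simp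
      obtain v where "v \<in> pverts G" using ne(2) by blast
      then have X2: "card X = 2" using deg full n \<open>n \<le> 4\<close> by fastforce
      have "\<N> G x = Y" if "x \<in> X" for x
        using card_subset_eq[OF finY neighbours_left(2)[OF that]] full[of x] that verts X2 card_eq
        by simp
      then have "E `` {x} = Y" if "x \<in> X" for x using neighbours_left(1) that by blast
      then have "E = X \<times> Y" using E by blast
      then show ?thesis using complete_isomorphic_cycle_graph_4 X2 card_eq by simp
    qed
    then show ?thesis
      using le cycle_graph_4_isomorphic_spectral_radius_ge[OF assms(1)] by force
  qed
  have large: "\<rho> G \<le> (1 + sqrt (2 * real n - 3)) / 2 \<and>
      (\<rho> G = (1 + sqrt (2 * real n - 3)) / 2 \<longleftrightarrow> G \<cong>\<^sub>G P3_star ((n - 2) div 2))" if "n \<ge> 6"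
  proof -
    define k where "k = card X - 1"
    have k: "k > 0" "card X = k + 1" "card Y - 1 = k" "(n - 2) div 2 = k" and X3: "card X \<ge> 3"
      and nk: "2 * real n - 3 = 4 * real k + 1"
      using n that card_eq by (auto simp: k_def of_nat_diff)
    define l where "l = (1 + sqrt (2 * real n - 3)) / 2"
    have sq: "sqrt (4 * real k + 1) * sqrt (4 * real k + 1) = 4 * real k + 1" by simp
    have l: "l * l = l + real k"
      unfolding l_def nk using sq by (simp add: field_simps)
    have inE: "x \<in> X" "y \<in> Y" if "(x, y) \<in> E" for x y using that E by blast+
    have no_sq: "x = x' \<or> y = y'"
      if "(x, y) \<in> E" "(x, y') \<in> E" "(x', y) \<in> E" "(x', y') \<in> E" for x x' y y'
      using m.no_square[OF that(1,2,3,4)] X3 by blast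
    have sf: "square_free G"
      unfolding square_free_def
    proof (intro allI impI)
      fix u u' v v' assume *: "v \<in> \<N> G u \<inter> \<N> G u'" "v' \<in> \<N> G u \<inter> \<N> G u'"
      show "u = u' \<or> v = v'"
      proof (cases "u \<in> X")
        case True
        then have "(u, v) \<in> E" "(u, v') \<in> E" using * neighbours_left(1) by blast+
        moreover then have "(u', v) \<in> E" "(u', v') \<in> E"
          using * inE disj E by (auto simp: neighbours_def arcs)
        ultimately show ?thesis using no_sq by blast
      next
        case False
        then have "(v, u) \<in> E" "(v', u) \<in> E" using * inE by (auto simp: neighbours_def arcs)
        moreover then have "(v, u') \<in> E" "(v', u') \<in> E"
          using * inE disj E by (auto simp: neighbours_def arcs)
        ultimately show ?thesis using no_sq by blast
      qed
    qed
    have two: "(\<Sum>u\<in>\<N> G v. card (\<N> G u)) \<le> card (\<N> G v) + k" if "v \<in> pverts G" for v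
      using that verts two_step_left(1)[OF sf, of v] s.two_step_left(1)[OF sf, of v] k by auto
    have le: "\<rho> G \<le> l"
    proof -
      have "(2 * \<rho> G - 1)\<^sup>2 \<le> 4 * real k + 1"
        using spectral_radius_two_step_bound(1)[OF ne(2) k(1) two]
        by (simp add: power2_eq_square algebra_simps)
      then have "2 * \<rho> G - 1 \<le> sqrt (4 * real k + 1)" by (rule real_le_rsqrt)
      then show ?thesis by (simp add: l_def nk)
    qed
    have "G \<cong>\<^sub>G P3_star k" if eq: "\<rho> G = l"
    proof -
      have tight: "(\<Sum>u\<in>\<N> G v. card (\<N> G u)) = card (\<N> G v) + k" if "v \<in> pverts G" for v
        using spectral_radius_two_step_bound(2)[OF ne(2) k(1) two st _ that] eq l by simp
      have join: "\<exists>y. (x, y) \<in> E \<and> (x', y) \<in> E" if "x \<in> X" "x' \<in> X" "x \<noteq> x'" for x x'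
      proof -
        have "\<exists>u. u \<in> \<N> G x \<and> u \<in> \<N> G x'"
          using two_step_left(2)[OF sf that(1) _ that(2)] that tight[of x] verts k by auto
        then show ?thesis using neighbours_left(1) that by auto
      qed
      have meet: "\<exists>x. (x, y) \<in> E \<and> (x, y') \<in> E" if "y \<in> Y" "y' \<in> Y" "y \<noteq> y'" for y y'
      proof -
        have "\<exists>u. u \<in> \<N> G y \<and> u \<in> \<N> G y'"
          using s.two_step_left(2)[OF sf that(1) _ that(2)] that tight[of y] verts k by auto
        then show ?thesis using s.neighbours_left(1) that by auto
      qed
      obtain p y1 y2 where p: "p \<in> X" "y1 \<noteq> y2" "E `` {p} = {y1, y2}"
        by (rule m.exists_degree_two) (use X3 in auto)
      have "card Y \<ge> 3" using X3 card_eq by simp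
      then obtain r w c where "r \<in> X" "w \<in> Y" "bij_betw c (X - {r}) (Y - {w})"
        "E = (\<Union>x\<in>X - {r}. {(r, c x), (x, c x), (x, w)})"
        using near_pencil[OF E join meet no_sq p] by blast
      then show ?thesis using near_pencil_isomorphic by (simp add: k_def)
    qed
    \<comment> \<open>Conversely, an isomorphism gives \<open>l \<le> \<rho> G\<close>, which
      together with \<open>le\<close> is equality.\<close>
    then show ?thesis
      using le P3_star_isomorphic_spectral_radius_ge[OF assms(1) _ l k(1)]
      unfolding k(4) l_def[symmetric] by force
  qed
  show ?thesis using small large by blast
qed

end
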